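(* Let $G$ be a finitely generated metabelian group that is an extension $1\to M\to G\to Q\to 1$, where $M$ is abelian and $Q$ is free abelian, and suppose that there exists a $\mathbb{Z}Q$-submodule $N$ of $M$ such that $N$ is uniform and $C_Q(N)=\{1\}$. Let $\mathcal{L}\subset G$ be a lift of $Q$. Then: (i) $\mathcal{L}$ is a non-foldable subset of $G$. (ii) If moreover $N$ is torsion-free (as an abelian group), then for every non-zero element $m$ of $N$, the subset $\mathcal{L}\cdot\mathcal{Z}$ is a non-foldable subset of $G$, where $\mathcal{Z}$ is the cyclic subgroup generated by $m$.
   Context: In an extension $1\to M\to G\to Q\to 1$ with $M$ abelian, the conjugation action of $G$ on $M$ factors through $Q$ and makes $M$ a $\mathbb{Z}Q$-module. For a $\mathbb{Z}Q$-module $N$, $C_Q(N)=\{q\in Q : qn=n \text{ for all } n\in N\}$. A $\mathbb{Z}Q$-module $N$ is uniform if $N_1\cap N_2$ is non-zero for all non-zero submodules $N_1,N_2$ of $N$. A subset $\mathcal{L}\subset G$ is a lift of $Q$ if for every $q\in Q$ there is a unique $g\in\mathcal{L}$ whose projection to $Q$ is $q$ ($\mathcal{L}$ is not required to be a subgroup). For subsets $A,B$ of a group, $A\cdot B=\{ab : a\in A,b\in B\}$. A $G$-set is a non-empty set with a $G$-action (not necessarily transitive); it is faithful if only the identity of $G$ acts trivially. A subset $\mathcal{L}$ of a group $G$ is non-foldable if for every faithful $G$-set $X$ and every finite subset $\Sigma\subset\mathcal{L}$ there exists $x\in X$ such that the map $\Sigma\to X$, $g\mapsto gx$, is injective. 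*)

theory Defs
  imports "HOL-Algebra.Algebra"
begin

section \<open>Group rings and modules over them\<close>

text \<open>The integral group ring of \<open>Q\<close>: finitely supported functions from the carrier of \<open>Q\<close> to the
  integers, with the \<open>\<int>\<close>-bilinear extension of the multiplication of \<open>Q\<close>. The basis element
  belonging to \<open>q\<close> is \<^term>\<open>frag_of q\<close>.\<close>

definition group_ring :: "('q, 'b) monoid_scheme \<Rightarrow> ('q \<Rightarrow>\<^sub>0 int) ring" where
  "group_ring Q =
    \<lparr>carrier = {r. Poly_Mapping.keys r \<subseteq> carrier Q},
     monoid.mult = (\<lambda>r s. frag_extend (\<lambda>p. frag_extend (\<lambda>q. frag_of (p \<otimes>\<^bsub>Q\<^esub> q)) s) r),
     one = frag_of \<one>\<^bsub>Q\<^esub>, ring.zero = 0, add = (+)\<rparr>"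

text \<open>An abelian group \<open>A\<close>, written multiplicatively, on which a group \<open>Q\<close> acts by automorphisms,
  as a (left) module over the group ring of \<open>Q\<close>: the sum \<open>\<Sum> n\<^sub>q q\<close> sends \<open>x\<close> to the product of the
  \<open>n\<^sub>q\<close>-th powers of \<open>act q x\<close>. The fields \<^const>\<open>monoid.mult\<close> and \<^const>\<open>one\<close> play no role in a module.\<close>

definition action_module ::
    "('a, 'b) monoid_scheme \<Rightarrow> ('q \<Rightarrow> 'a \<Rightarrow> 'a) \<Rightarrow> ('q \<Rightarrow>\<^sub>0 int, 'a) module" where
  "action_module A act =
    \<lparr>carrier = carrier A, monoid.mult = undefined, one = undefined,
     ring.zero = \<one>\<^bsub>A\<^esub>, add = (\<otimes>\<^bsub>A\<^esub>),
     smult = (\<lambda>r x. \<Otimes>\<^bsub>A\<^esub>q \<in> Poly_Mapping.keys r. act q x [^]\<^bsub>A\<^esub> Poly_Mapping.lookup r q)\<rparr>"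

definition uniform_module :: "('r, 's) ring_scheme \<Rightarrow> ('r, 'a, 't) module_scheme \<Rightarrow> bool" where
  "uniform_module R V \<longleftrightarrow>
    (\<forall>N1 N2. submodule N1 R V \<and> submodule N2 R V \<and> N1 \<noteq> {\<zero>\<^bsub>V\<^esub>} \<and> N2 \<noteq> {\<zero>\<^bsub>V\<^esub>}
      \<longrightarrow> N1 \<inter> N2 \<noteq> {\<zero>\<^bsub>V\<^esub>})"

definition module_centralizer ::
    "('q, 'b) monoid_scheme \<Rightarrow> ('q \<Rightarrow>\<^sub>0 int, 'a, 't) module_scheme \<Rightarrow> 'q set" where
  "module_centralizer Q V = {q \<in> carrier Q. \<forall>x \<in> carrier V. frag_of q \<odot>\<^bsub>V\<^esub> x = x}"

section \<open>Group extensions with abelian kernel\<close>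

text \<open>For a surjective homomorphism \<open>p\<close> from \<open>G\<close> onto \<open>Q\<close>, the element \<open>q\<close> acts as conjugation by a
  preimage of \<open>q\<close>. On an abelian kernel the choice of the preimage does not matter, see
  \<open>conj_action_eq\<close> below.\<close>

definition conj_action :: "('g, 'b) monoid_scheme \<Rightarrow> ('g \<Rightarrow> 'q) \<Rightarrow> 'q \<Rightarrow> 'g \<Rightarrow> 'g" where
  "conj_action G p q x =
    (let g = (SOME g. g \<in> carrier G \<and> p g = q) in g \<otimes>\<^bsub>G\<^esub> x \<otimes>\<^bsub>G\<^esub> inv\<^bsub>G\<^esub> g)"

definition kernel_module ::
    "('g, 'b) monoid_scheme \<Rightarrow> ('g \<Rightarrow> 'q) \<Rightarrow> 'g set \<Rightarrow> ('q \<Rightarrow>\<^sub>0 int, 'g) module" where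
  "kernel_module G p M = action_module (G\<lparr>carrier := M\<rparr>) (conj_action G p)"

definition lift :: "('g, 'b) monoid_scheme \<Rightarrow> ('q, 'c) monoid_scheme \<Rightarrow> ('g \<Rightarrow> 'q) \<Rightarrow> 'g set \<Rightarrow> bool" where
  "lift G Q p L \<longleftrightarrow> L \<subseteq> carrier G \<and> (\<forall>q \<in> carrier Q. \<exists>!g. g \<in> L \<and> p g = q)"

section \<open>Properties of groups\<close>

definition finitely_generated :: "('g, 'b) monoid_scheme \<Rightarrow> bool" where
  "finitely_generated G \<longleftrightarrow> (\<exists>S. finite S \<and> S \<subseteq> carrier G \<and> generate G S = carrier G)"

definition metabelian :: "('g, 'b) monoid_scheme \<Rightarrow> bool" where
  "metabelian G \<longleftrightarrow> group G \<and> comm_group (G\<lparr>carrier := derived G (carrier G)\<rparr>)"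

text \<open>A basis of \<open>Q\<close> can be taken inside \<open>Q\<close>, so it is enough to let \<open>S\<close> range over
  sets of elements of the type of \<open>Q\<close>.\<close>

definition free_abelian :: "('q, 'b) monoid_scheme \<Rightarrow> bool" where
  "free_abelian Q \<longleftrightarrow> group Q \<and> (\<exists>S :: 'q set. Q \<cong> free_Abelian_group S)"

definition torsion_free :: "('a, 'b) monoid_scheme \<Rightarrow> bool" where
  "torsion_free A \<longleftrightarrow> (\<forall>x \<in> carrier A. \<forall>n :: nat. n > 0 \<and> x [^]\<^bsub>A\<^esub> n = \<one>\<^bsub>A\<^esub> \<longrightarrow> x = \<one>\<^bsub>A\<^esub>)"

section \<open>Non-foldable subsets\<close>

text \<open>\<open>HOL\<close> has no quantification over types, so the type of the points of the \<open>G\<close>-sets is a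
  parameter. The full notion is \<^term>\<open>nonfoldable TYPE('x) G L\<close> for every type \<open>'x\<close>; in a theorem with
  this conclusion and no other occurrence of \<open>'x\<close>, the type variable is universally quantified.\<close>

definition nonfoldable :: "'x itself \<Rightarrow> ('g, 'b) monoid_scheme \<Rightarrow> 'g set \<Rightarrow> bool" where
  "nonfoldable _ G L \<longleftrightarrow> L \<subseteq> carrier G \<and>
    (\<forall>(S :: 'x set) \<phi> F. S \<noteq> {} \<and> faithful_action G S \<phi> \<and> finite F \<and> F \<subseteq> L
      \<longrightarrow> (\<exists>x \<in> S. inj_on (\<lambda>g. \<phi> g x) F))"

section \<open>The definitions yield rings, modules and actions\<close>

lemma group_ring_simps:
  "carrier (group_ring Q) = {r. Poly_Mapping.keys r \<subseteq> carrier Q}"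
  "monoid.mult (group_ring Q) = (\<lambda>r s. frag_extend (\<lambda>p. frag_extend (\<lambda>q. frag_of (p \<otimes>\<^bsub>Q\<^esub> q)) s) r)"
  "one (group_ring Q) = frag_of \<one>\<^bsub>Q\<^esub>" "ring.zero (group_ring Q) = 0" "add (group_ring Q) = (+)"
  by (simp_all add: group_ring_def)

lemma action_module_simps:
  "carrier (action_module A act) = carrier A"
  "ring.zero (action_module A act) = \<one>\<^bsub>A\<^esub>" "add (action_module A act) = (\<otimes>\<^bsub>A\<^esub>)"
  "smult (action_module A act) =
    (\<lambda>r x. \<Otimes>\<^bsub>A\<^esub>q \<in> Poly_Mapping.keys r. act q x [^]\<^bsub>A\<^esub> Poly_Mapping.lookup r q)"
  by (simp_all add: action_module_def)

lemma frag_extend_diff_fun: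
  "frag_extend (\<lambda>p. f p - g p) r = frag_extend f r - frag_extend g r"
  by (induction r rule: frag_induction[OF subset_UNIV]) (auto simp: frag_extend_diff)

lemma frag_extend_zero_fun: "frag_extend (\<lambda>p. 0) r = 0"
  by (simp add: frag_extend_def)

lemma cring_group_ring:
  assumes "comm_group Q"
  shows "cring (group_ring Q)"
proof -
  interpret Q: comm_group Q by fact
  define m where "m = monoid.mult (group_ring Q)"
  have m_of: "m (frag_of p) (frag_of q) = frag_of (p \<otimes>\<^bsub>Q\<^esub> q)" for p q
    by (simp add: m_def group_ring_simps)
  have mr: "m r (s - t) = m r s - m r t" and ml: "m (s - t) r = m s r - m t r"
    and m0: "m r 0 = 0" "m 0 r = 0" for r s t
    by (simp_all add: m_def group_ring_simps frag_extend_diff frag_extend_diff_fun frag_extend_zero_fun)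
  have ml': "m (s + t) r = m s r + m t r" for r s t
    by (simp add: m_def group_ring_simps frag_extend_add)
  let ?C = "{r. Poly_Mapping.keys r \<subseteq> carrier Q}"
  have closed: "m r s \<in> ?C" if "r \<in> ?C" "s \<in> ?C" for r s
  proof -
    have "\<And>p. p \<in> carrier Q \<Longrightarrow>
        Poly_Mapping.keys (frag_extend (\<lambda>q. frag_of (p \<otimes>\<^bsub>Q\<^esub> q)) s) \<subseteq> carrier Q"
      using that by (intro order_trans[OF keys_frag_extend]) (auto split: if_splits)
    then have "Poly_Mapping.keys (m r s) \<subseteq> carrier Q"
      unfolding m_def group_ring_simps using that by (intro order_trans[OF keys_frag_extend]) blast
    then show ?thesis by simp
  qed
  have one: "m (frag_of \<one>\<^bsub>Q\<^esub>) r = r" if "r \<in> ?C" for r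
  proof -
    from that have "Poly_Mapping.keys r \<subseteq> carrier Q" by simp
    then show ?thesis by (induction rule: frag_induction) (auto simp: m0 m_of mr)
  qed
  have comm: "m r s = m s r" if "r \<in> ?C" "s \<in> ?C" for r s
  proof -
    have *: "m r (frag_of q) = m (frag_of q) r"
      if "Poly_Mapping.keys r \<subseteq> carrier Q" "q \<in> carrier Q" for r q
      using that by (induction rule: frag_induction) (auto simp: m0 m_of mr ml Q.m_comm)
    from that have "Poly_Mapping.keys s \<subseteq> carrier Q" by simp
    then show ?thesis using * \<open>r \<in> ?C\<close>
      by (induction rule: frag_induction) (auto simp: m0 mr ml)
  qed
  have assoc: "m (m r s) t = m r (m s t)" if "r \<in> ?C" "s \<in> ?C" "t \<in> ?C" for r s t
  proof -
    have 1: "m (m (frag_of p) (frag_of q)) t = m (frag_of p) (m (frag_of q) t)"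
      if "Poly_Mapping.keys t \<subseteq> carrier Q" "p \<in> carrier Q" "q \<in> carrier Q" for p q t
      using that by (induction rule: frag_induction) (auto simp: m0 m_of mr ml Q.m_assoc)
    have 2: "m (m (frag_of p) s) t = m (frag_of p) (m s t)"
      if "Poly_Mapping.keys s \<subseteq> carrier Q" "p \<in> carrier Q" "Poly_Mapping.keys t \<subseteq> carrier Q" for p s t
      using that by (induction rule: frag_induction) (auto simp: m0 mr ml 1)
    from that have "Poly_Mapping.keys r \<subseteq> carrier Q" by simp
    then show ?thesis using \<open>s \<in> ?C\<close> \<open>t \<in> ?C\<close>
      by (induction rule: frag_induction) (auto simp: m0 mr ml 2)
  qed
  show ?thesis
  proof (rule cringI)
    show "abelian_group (group_ring Q)"
    proof (rule abelian_groupI)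
      fix x assume "x \<in> carrier (group_ring Q)"
      then show "\<exists>y\<in>carrier (group_ring Q). y \<oplus>\<^bsub>group_ring Q\<^esub> x = \<zero>\<^bsub>group_ring Q\<^esub>"
        by (intro bexI[of _ "- x"]) (auto simp: group_ring_simps)
    qed (auto simp: group_ring_simps dest!: subsetD[OF keys_add])
    show "comm_monoid (group_ring Q)"
      using closed one comm assoc
      by (intro comm_monoidI) (auto simp: m_def[symmetric] group_ring_simps(1,3))
    fix x y z
    show "(x \<oplus>\<^bsub>group_ring Q\<^esub> y) \<otimes>\<^bsub>group_ring Q\<^esub> z =
       x \<otimes>\<^bsub>group_ring Q\<^esub> z \<oplus>\<^bsub>group_ring Q\<^esub> y \<otimes>\<^bsub>group_ring Q\<^esub> z"
      using ml' by (simp add: m_def[symmetric] group_ring_simps(5))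
  qed
qed

lemma module_action_module:
  assumes "comm_group Q" "comm_group A"
    and closed: "\<And>q x. q \<in> carrier Q \<Longrightarrow> x \<in> carrier A \<Longrightarrow> act q x \<in> carrier A"
    and hom: "\<And>q x y. q \<in> carrier Q \<Longrightarrow> x \<in> carrier A \<Longrightarrow> y \<in> carrier A \<Longrightarrow>
        act q (x \<otimes>\<^bsub>A\<^esub> y) = act q x \<otimes>\<^bsub>A\<^esub> act q y"
    and one: "\<And>x. x \<in> carrier A \<Longrightarrow> act \<one>\<^bsub>Q\<^esub> x = x"
    and comp: "\<And>p q x. p \<in> carrier Q \<Longrightarrow> q \<in> carrier Q \<Longrightarrow> x \<in> carrier A \<Longrightarrow>
        act (p \<otimes>\<^bsub>Q\<^esub> q) x = act p (act q x)"
  shows "module (group_ring Q) (action_module A act)"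
proof -
  interpret Q: comm_group Q by fact
  interpret A: comm_group A by fact
  interpret R: cring "group_ring Q" by (rule cring_group_ring) fact
  define sm where "sm = smult (action_module A act)"
  have sm: "sm r x = (\<Otimes>\<^bsub>A\<^esub>q \<in> Poly_Mapping.keys r. act q x [^]\<^bsub>A\<^esub> Poly_Mapping.lookup r q)" for r x
    by (simp add: sm_def action_module_simps)
  have sm_cl: "sm r x \<in> carrier A" if "Poly_Mapping.keys r \<subseteq> carrier Q" "x \<in> carrier A" for r x
    unfolding sm using that closed by (intro A.finprod_closed) auto
  have sm_sup: "sm r x = (\<Otimes>\<^bsub>A\<^esub>q \<in> F. act q x [^]\<^bsub>A\<^esub> Poly_Mapping.lookup r q)"
    if "finite F" "Poly_Mapping.keys r \<subseteq> F" "F \<subseteq> carrier Q" "x \<in> carrier A" for r x F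
    unfolding sm using that closed
    by (intro A.finprod_mono_neutral_cong_left) (auto simp: in_keys_iff)
  have add: "sm (r + s) x = sm r x \<otimes>\<^bsub>A\<^esub> sm s x"
    if "Poly_Mapping.keys r \<subseteq> carrier Q" "Poly_Mapping.keys s \<subseteq> carrier Q" "x \<in> carrier A" for r s x
  proof -
    let ?F = "Poly_Mapping.keys r \<union> Poly_Mapping.keys s"
    have F: "finite ?F" "?F \<subseteq> carrier Q" "Poly_Mapping.keys (r + s) \<subseteq> ?F"
      using that keys_add[of r s] by auto
    have "sm (r + s) x = (\<Otimes>\<^bsub>A\<^esub>q \<in> ?F. act q x [^]\<^bsub>A\<^esub> Poly_Mapping.lookup r q \<otimes>\<^bsub>A\<^esub>
        act q x [^]\<^bsub>A\<^esub> Poly_Mapping.lookup s q)"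
      using F that closed
      by (subst sm_sup[of ?F])
        (auto simp: lookup_add A.int_pow_mult intro!: A.finprod_cong')
    also have "\<dots> = sm r x \<otimes>\<^bsub>A\<^esub> sm s x"
      using F that closed
      by (subst A.finprod_multf) (auto simp: sm_sup[of ?F])
    finally show ?thesis .
  qed
  have sm0: "sm 0 x = \<one>\<^bsub>A\<^esub>" for x by (simp add: sm)
  have sm_diff: "sm (r - s) x = sm r x \<otimes>\<^bsub>A\<^esub> inv\<^bsub>A\<^esub> sm s x"
    if "Poly_Mapping.keys r \<subseteq> carrier Q" "Poly_Mapping.keys s \<subseteq> carrier Q" "x \<in> carrier A" for r s x
  proof -
    have k: "Poly_Mapping.keys (r - s) \<subseteq> carrier Q"
      using that keys_diff[of r s] by blast
    from add[OF k that(2,3)] show ?thesis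
      using that k by (simp add: A.inv_solve_right sm_cl)
  qed
  have sm_of: "sm (frag_of q) x = act q x" if "q \<in> carrier Q" "x \<in> carrier A" for q x
    using that closed by (simp add: sm)
  have radd: "sm r (x \<otimes>\<^bsub>A\<^esub> y) = sm r x \<otimes>\<^bsub>A\<^esub> sm r y"
    if "Poly_Mapping.keys r \<subseteq> carrier Q" "x \<in> carrier A" "y \<in> carrier A" for r x y
  proof -
    have "sm r (x \<otimes>\<^bsub>A\<^esub> y) = (\<Otimes>\<^bsub>A\<^esub>q \<in> Poly_Mapping.keys r.
      act q x [^]\<^bsub>A\<^esub> Poly_Mapping.lookup r q \<otimes>\<^bsub>A\<^esub> act q y [^]\<^bsub>A\<^esub> Poly_Mapping.lookup r q)"
      unfolding sm using that closed
      by (intro A.finprod_cong') (auto simp: hom A.int_pow_distrib subset_iff)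
    then show ?thesis unfolding sm
      using that closed by (subst (asm) A.finprod_multf) auto
  qed
  have rone: "sm r \<one>\<^bsub>A\<^esub> = \<one>\<^bsub>A\<^esub>" if "Poly_Mapping.keys r \<subseteq> carrier Q" for r
    using radd[OF that, of "\<one>\<^bsub>A\<^esub>" "\<one>\<^bsub>A\<^esub>"] sm_cl[OF that, of "\<one>\<^bsub>A\<^esub>"] by simp
  have rinv: "sm r (inv\<^bsub>A\<^esub> x) = inv\<^bsub>A\<^esub> sm r x"
    if "Poly_Mapping.keys r \<subseteq> carrier Q" "x \<in> carrier A" for r x
    using radd[OF that(1), of "inv\<^bsub>A\<^esub> x" x] that
    by (metis A.inv_closed A.inv_equality A.l_inv rone sm_cl)
  let ?m = "monoid.mult (group_ring Q)"
  have mk: "Poly_Mapping.keys (?m r s) \<subseteq> carrier Q"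
    if "Poly_Mapping.keys r \<subseteq> carrier Q" "Poly_Mapping.keys s \<subseteq> carrier Q" for r s
    using R.m_closed[of r s] that by (simp add: group_ring_simps(1))
  have md: "?m r (s - t) = ?m r s - ?m r t" "?m (s - t) r = ?m s r - ?m t r"
    "?m r 0 = 0" "?m 0 r = 0" for r s t
    by (simp_all add: group_ring_simps frag_extend_diff frag_extend_diff_fun frag_extend_zero_fun)
  have kof: "Poly_Mapping.keys (frag_of q) \<subseteq> carrier Q" if "q \<in> carrier Q" for q
    using that by simp
  have assoc1: "Poly_Mapping.keys s \<subseteq> carrier Q \<and>
      sm (?m (frag_of p) s) x = sm (frag_of p) (sm s x)"
    if "Poly_Mapping.keys s \<subseteq> carrier Q" "p \<in> carrier Q" "x \<in> carrier A" for p s x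
    using that
  proof (induction rule: frag_induction)
    case zero
    then show ?case by (simp add: md sm0 rone)
  next
    case (one q)
    then show ?case by (simp add: group_ring_simps sm_of comp closed)
  next
    case (diff a b)
    then have "Poly_Mapping.keys (a - b) \<subseteq> carrier Q"
      using keys_diff[of a b] by blast
    with diff show ?case
      by (simp add: md sm_diff mk radd rinv sm_cl)
  qed
  have assoc: "Poly_Mapping.keys r \<subseteq> carrier Q \<and> sm (?m r s) x = sm r (sm s x)"
    if "Poly_Mapping.keys r \<subseteq> carrier Q" "Poly_Mapping.keys s \<subseteq> carrier Q" "x \<in> carrier A" for r s x
    using that
  proof (induction rule: frag_induction)
    case zero
    then show ?case by (simp add: md sm0)
  next
    case (one q)
    then show ?case using assoc1 by simp
  next
    case (diff a b)
    then have "Poly_Mapping.keys (a - b) \<subseteq> carrier Q"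
      using keys_diff[of a b] by blast
    with diff show ?case
      by (simp add: md sm_diff mk sm_cl)
  qed
  show ?thesis
  proof (rule moduleI)
    show "abelian_group (action_module A act)"
    proof (rule abelian_groupI)
      fix x assume "x \<in> carrier (action_module A act)"
      then show "\<exists>y\<in>carrier (action_module A act).
          y \<oplus>\<^bsub>action_module A act\<^esub> x = \<zero>\<^bsub>action_module A act\<^esub>"
        by (intro bexI[of _ "inv\<^bsub>A\<^esub> x"]) (auto simp: action_module_simps)
    qed (auto simp: action_module_simps A.m_ac)
  qed (use sm_cl add radd assoc in
        \<open>auto simp: sm_def[symmetric] action_module_simps(1,2,3) group_ring_simps(1,3,5) R.is_cring
          sm_of one\<close>)
qed

lemma conj_action_eq:
  assumes "group G" "group Q" "p \<in> hom G Q" "comm_group (G\<lparr>carrier := kernel G Q p\<rparr>)"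
    and g: "g \<in> carrier G" and x: "x \<in> kernel G Q p"
  shows "conj_action G p (p g) x = g \<otimes>\<^bsub>G\<^esub> x \<otimes>\<^bsub>G\<^esub> inv\<^bsub>G\<^esub> g"
proof -
  interpret G: group G by fact
  interpret p: group_hom G Q p
    using assms by (simp add: group_hom_def group_hom_axioms_def)
  interpret K: comm_group "G\<lparr>carrier := kernel G Q p\<rparr>" by fact
  define h where "h = (SOME h. h \<in> carrier G \<and> p h = p g)"
  have h: "h \<in> carrier G" "p h = p g"
    using someI[of "\<lambda>h. h \<in> carrier G \<and> p h = p g" g] g by (auto simp: h_def)
  have xG: "x \<in> carrier G" using x by (simp add: kernel_def)
  let ?k = "inv\<^bsub>G\<^esub> h \<otimes>\<^bsub>G\<^esub> g"
  have k: "?k \<in> kernel G Q p" using g h by (simp add: kernel_def)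
  have kx: "?k \<otimes>\<^bsub>G\<^esub> x = x \<otimes>\<^bsub>G\<^esub> ?k"
    using K.m_comm[of ?k x] k x by simp
  have "h \<otimes>\<^bsub>G\<^esub> x \<otimes>\<^bsub>G\<^esub> inv\<^bsub>G\<^esub> h = h \<otimes>\<^bsub>G\<^esub> (x \<otimes>\<^bsub>G\<^esub> ?k) \<otimes>\<^bsub>G\<^esub> inv\<^bsub>G\<^esub> g"
    using g h xG by (simp add: G.m_assoc)
  also have "\<dots> = g \<otimes>\<^bsub>G\<^esub> x \<otimes>\<^bsub>G\<^esub> inv\<^bsub>G\<^esub> g"
    unfolding kx[symmetric] using g h xG by (simp add: G.m_assoc[symmetric])
  finally show ?thesis
    by (simp add: conj_action_def h_def[symmetric])
qed

lemma module_kernel_module: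
  assumes "group G" "comm_group Q" "p \<in> epi G Q" "M = kernel G Q p"
    "comm_group (G\<lparr>carrier := M\<rparr>)"
  shows "module (group_ring Q) (kernel_module G p M)"
proof -
  interpret G: group G by fact
  interpret Q: comm_group Q by fact
  have "p \<in> hom G Q" and surj: "p ` carrier G = carrier Q"
    using assms(3) by (auto simp: epi_def)
  interpret p: group_hom G Q p
    using \<open>p \<in> hom G Q\<close> by unfold_locales
  have M: "x \<in> carrier G" if "x \<in> M" for x using that assms(4) by (auto simp: kernel_def)
  have eq: "conj_action G p (p g) x = g \<otimes>\<^bsub>G\<^esub> x \<otimes>\<^bsub>G\<^esub> inv\<^bsub>G\<^esub> g"
    if "g \<in> carrier G" "x \<in> M" for g x
    using conj_action_eq[OF assms(1) Q.is_group \<open>p \<in> hom G Q\<close>, of g x] that assms(4,5) by simp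
  have cl: "g \<otimes>\<^bsub>G\<^esub> x \<otimes>\<^bsub>G\<^esub> inv\<^bsub>G\<^esub> g \<in> M" if "g \<in> carrier G" "x \<in> M" for g x
    using that by (auto simp: assms(4) kernel_def)
  show ?thesis
    unfolding kernel_module_def
  proof (rule module_action_module[OF assms(2,5)], goal_cases)
    case (1 q x)
    then obtain g where "g \<in> carrier G" "q = p g" using surj by blast
    then show ?case using 1 eq cl by simp
  next
    case (2 q x y)
    then obtain g where g: "g \<in> carrier G" "q = p g" using surj by blast
    have xy: "x \<otimes>\<^bsub>G\<^esub> y \<in> M" using 2 by (auto simp: assms(4) kernel_def)
    show ?case using 2 g xy M
      by (simp add: eq G.m_assoc G.inv_solve_left)
  next
    case (3 x)
    then show ?case using eq[of "\<one>\<^bsub>G\<^esub>" x] M by simp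
  next
    case (4 a b x)
    then obtain g h where g: "g \<in> carrier G" "a = p g" and h: "h \<in> carrier G" "b = p h"
      using surj by blast
    show ?case
      using 4 g h M eq[of "g \<otimes>\<^bsub>G\<^esub> h" x] eq[of g "h \<otimes>\<^bsub>G\<^esub> x \<otimes>\<^bsub>G\<^esub> inv\<^bsub>G\<^esub> h"] cl[of h x] eq[of h x]
      by (simp add: G.m_assoc G.inv_mult_group)
  qed
qed

end

theory Submission
  imports Defs
begin

text \<open>
  If the differences of a finite set cannot be separated at any point, then every point stabilizer \<open>H\<close>
  contains, for all \<open>n \<in> N\<close>, the conjugate by \<open>n\<close> of one of finitely many elements \<open>h\<close> outside \<open>M\<close>.
  Thus \<open>N\<close> is covered by one coset of \<open>{n. (h - 1) n \<in> H}\<close> for each \<open>h\<close>, and by B. H. Neumann's lemma one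
  of these subgroups has bounded index. By uniformity the intersection \<open>K\<close> of the modules \<open>(h - 1) N\<close> is
  non-zero; \<open>H \<inter> K\<close> has bounded index in \<open>K\<close> and is invariant under some \<open>h\<close>, so for a suitable \<open>r > 0\<close>,
  independent of the point, \<open>H\<close> contains \<open>r K\<close> and \<open>(h\<^sup>r - 1) K\<close> for some \<open>h\<close>. By faithfulness \<open>r K = 0\<close>.
  Since \<open>M\<close> is Noetherian (P. Hall), an argument of Fitting type with the uniform module \<open>N\<close> shows that only
  the identity of \<open>Q\<close> centralizes such a \<open>K\<close>. Hence the \<open>(h\<^sup>r - 1) K\<close> are non-zero, and by uniformity
  so is their intersection, which acts trivially: a contradiction.

  For \<open>N\<close> torsion-free, some differences lie in the cyclic group generated by \<open>m\<close>, and they have a common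
  non-zero multiple \<open>z\<close>. Every stabilizer now contains \<open>r K\<close> or the submodule generated by \<open>z\<close>, hence their
  intersection, which is non-zero.
\<close>

section \<open>Ascending chain conditions for operator groups\<close>

definition acc_sets :: "'a set set \<Rightarrow> bool" where
  "acc_sets \<A> \<longleftrightarrow> (\<forall>U :: nat \<Rightarrow> 'a set. mono U \<and> range U \<subseteq> \<A> \<longrightarrow> (\<exists>n. \<forall>k \<ge> n. U k = U n))"

lemma acc_setsI:
  fixes \<A> :: "'a set set"
  assumes "\<And>U :: nat \<Rightarrow> 'a set. mono U \<Longrightarrow> (\<And>i. U i \<in> \<A>) \<Longrightarrow> \<exists>n. \<forall>k \<ge> n. U k = U n"
  shows "acc_sets \<A>"
  unfolding acc_sets_def
proof (intro allI impI)
  fix U :: "nat \<Rightarrow> 'a set" assume "mono U \<and> range U \<subseteq> \<A>"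
  then show "\<exists>n. \<forall>k \<ge> n. U k = U n" by (intro assms) auto
qed

lemma acc_setsD:
  fixes U :: "nat \<Rightarrow> 'a set"
  assumes "acc_sets \<A>" "mono U" "\<And>i. U i \<in> \<A>"
  obtains n where "\<And>k. k \<ge> n \<Longrightarrow> U k = U n"
proof -
  have "range U \<subseteq> \<A>" using assms(3) by blast
  then obtain n where "\<forall>k \<ge> n. U k = U n" using assms(1,2) unfolding acc_sets_def by blast
  then show thesis by (metis that)
qed

lemma acc_sets_pair:
  fixes \<A> :: "'a set set"
  assumes \<B>: "acc_sets \<B>" and \<C>: "acc_sets \<C>"
    and f: "\<And>D. D \<in> \<A> \<Longrightarrow> f D \<in> \<B>" "\<And>D Y. D \<subseteq> Y \<Longrightarrow> f D \<subseteq> f Y"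
    and g: "\<And>D. D \<in> \<A> \<Longrightarrow> g D \<in> \<C>" "\<And>D Y. D \<subseteq> Y \<Longrightarrow> g D \<subseteq> g Y"
    and eq: "\<And>D Y. D \<in> \<A> \<Longrightarrow> Y \<in> \<A> \<Longrightarrow> D \<subseteq> Y \<Longrightarrow> f D = f Y \<Longrightarrow> g D = g Y \<Longrightarrow> Y \<subseteq> D"
  shows "acc_sets \<A>"
proof (rule acc_setsI)
  fix U :: "nat \<Rightarrow> 'a set" assume U: "mono U" "\<And>i. U i \<in> \<A>"
  obtain m where m: "\<And>k. k \<ge> m \<Longrightarrow> f (U k) = f (U m)"
    by (rule acc_setsD[OF \<B>, of "\<lambda>i. f (U i)"]) (use U f in \<open>auto simp: mono_def\<close>)
  obtain n where n: "\<And>k. k \<ge> n \<Longrightarrow> g (U k) = g (U n)"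
    by (rule acc_setsD[OF \<C>, of "\<lambda>i. g (U i)"]) (use U g in \<open>auto simp: mono_def\<close>)
  have "U k = U (max m n)" if "k \<ge> max m n" for k
  proof
    show "U (max m n) \<subseteq> U k" using U(1) that by (auto simp: mono_def)
    then show "U k \<subseteq> U (max m n)"
      using m[of k] m[of "max m n"] n[of k] n[of "max m n"] that U(2) eq[of "U (max m n)" "U k"] by simp
  qed
  then show "\<exists>n. \<forall>k \<ge> n. U k = U n" by blast
qed

lemma acc_sets_filtration:
  fixes \<A> :: "'a set set"
  assumes \<B>: "acc_sets \<B>"
    and f: "\<And>D n. D \<in> \<A> \<Longrightarrow> f n D \<in> \<B>" "\<And>D Y n. D \<subseteq> Y \<Longrightarrow> f n D \<subseteq> f n Y"
    and step: "\<And>D n. D \<in> \<A> \<Longrightarrow> f n D \<subseteq> f (Suc n) D"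
    and eq: "\<And>D Y. D \<in> \<A> \<Longrightarrow> Y \<in> \<A> \<Longrightarrow> D \<subseteq> Y \<Longrightarrow> (\<And>n. f n D = f n Y) \<Longrightarrow> Y \<subseteq> D"
  shows "acc_sets \<A>"
proof (rule acc_setsI)
  fix U :: "nat \<Rightarrow> 'a set" assume U: "mono U" "\<And>i. U i \<in> \<A>"
  have mono: "f m (U i) \<subseteq> f n (U j)" if "m \<le> n" "i \<le> j" for m n i j
  proof -
    have "f m (U i) \<subseteq> f n (U i)"
      using that(1) by (induction rule: dec_induct) (use step[OF U(2)] in auto)
    also have "\<dots> \<subseteq> f n (U j)" using f(2) U(1) that(2) by (auto simp: mono_def)
    finally show ?thesis .
  qed
  obtain d where d: "\<And>k. k \<ge> d \<Longrightarrow> f k (U k) = f d (U d)"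
    by (rule acc_setsD[OF \<B>, of "\<lambda>i. f i (U i)"]) (use U f mono in \<open>auto simp: mono_def\<close>)
  have "\<exists>s. \<forall>k \<ge> s. f n (U k) = f n (U s)" for n
  proof -
    obtain s where "\<And>k. k \<ge> s \<Longrightarrow> f n (U k) = f n (U s)"
      by (rule acc_setsD[OF \<B>, of "\<lambda>i. f n (U i)"]) (use U f mono in \<open>auto simp: mono_def\<close>)
    then show ?thesis by blast
  qed
  then obtain s where s: "\<And>n k. k \<ge> s n \<Longrightarrow> f n (U k) = f n (U (s n))" by metis
  define t where "t = Max (insert d (s ` {..<d}))"
  have t: "d \<le> t" "\<And>n. n < d \<Longrightarrow> s n \<le> t" by (auto simp: t_def)
  have stable: "f n (U k) = f n (U t)" if "k \<ge> t" for n k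
  proof (cases "n < d")
    case True
    then show ?thesis using s[of n k] s[of n t] t(2)[of n] that by simp
  next
    case False
    have "f n (U j) = f d (U d)" if "j \<ge> t" for j
    proof
      show "f d (U d) \<subseteq> f n (U j)" using False that t by (intro mono) auto
      have "f n (U j) \<subseteq> f (max n j) (U (max n j))" by (intro mono) auto
      also have "\<dots> = f d (U d)" using False by (intro d) auto
      finally show "f n (U j) \<subseteq> f d (U d)" .
    qed
    then show ?thesis using that by simp
  qed
  have "U k = U t" if "k \<ge> t" for k
  proof
    show sub: "U t \<subseteq> U k" using U(1) that by (auto simp: mono_def)
    show "U k \<subseteq> U t"
    proof (rule eq[OF U(2) U(2) sub])
      show "f n (U t) = f n (U k)" for n using stable[OF that] by simp
    qed
  qed
  then show "\<exists>n. \<forall>k \<ge> n. U k = U n" by blast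
qed

lemma acc_sets_int_subgroups: "acc_sets {J :: int set. 0 \<in> J \<and> (\<forall>x\<in>J. \<forall>y\<in>J. x - y \<in> J)}"
proof (rule acc_setsI)
  fix U :: "nat \<Rightarrow> int set"
  assume U: "mono U" "\<And>i. U i \<in> {J. 0 \<in> J \<and> (\<forall>x\<in>J. \<forall>y\<in>J. x - y \<in> J)}"
  have zero: "0 \<in> U i" and diff: "x \<in> U i \<Longrightarrow> y \<in> U i \<Longrightarrow> x - y \<in> U i" for i x y
    using U(2)[of i] by auto
  have neg: "- x \<in> U i" if "x \<in> U i" for i x
    using diff[OF zero that] by simp
  have add: "x + y \<in> U i" if "x \<in> U i" "y \<in> U i" for i x y
    using diff[OF that(1) neg[OF that(2)]] by simp
  have mult: "z * x \<in> U i" if "x \<in> U i" for i x z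
    by (induction z rule: int_induct[where k = 0])
      (use that zero add diff in \<open>auto simp: algebra_simps\<close>)
  have sub: "U i \<subseteq> U j" if "i \<le> j" for i j using U(1) that by (auto simp: mono_def)
  show "\<exists>n. \<forall>k \<ge> n. U k = U n"
  proof (cases "\<exists>i. \<exists>x\<in>U i. x > 0")
    case False
    have "U i = {0}" for i
    proof -
      have "x = 0" if "x \<in> U i" for x
        using False that neg[OF that] by (metis linorder_neqE neg_0_less_iff_less)
      then show ?thesis using zero by auto
    qed
    then show ?thesis by simp
  next
    case True
    then have ex: "\<exists>d. \<exists>i. d > 0 \<and> int d \<in> U i"
      by (metis zero_less_imp_eq_int)
    define d where "d = (LEAST d. \<exists>i. d > 0 \<and> int d \<in> U i)"
    from LeastI_ex[OF ex] obtain n where n: "d > 0" "int d \<in> U n"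
      unfolding d_def by auto
    have "U k = U n" if "k \<ge> n" for k
    proof
      show "U k \<subseteq> U n"
      proof
        fix x assume x: "x \<in> U k"
        have "int d \<in> U k" using n sub[OF that] by auto
        then have r: "x mod int d \<in> U k"
          using diff[OF x mult[of "int d" k "x div int d"]] by (simp add: minus_div_mult_eq_mod)
        have "x mod int d = 0"
        proof (rule ccontr)
          assume "x mod int d \<noteq> 0"
          moreover have "x mod int d \<ge> 0" "x mod int d < int d" using n by auto
          ultimately have "0 < nat (x mod int d)" "int (nat (x mod int d)) = x mod int d"
            "nat (x mod int d) < d"
            by auto
          then show False
            using not_less_Least[of "nat (x mod int d)" "\<lambda>d. \<exists>i. d > 0 \<and> int d \<in> U i", folded d_def] r
            by metis
        qed
        then show "x \<in> U n"
          using mult[OF n(2), of "x div int d"] by (simp add: mult.commute mod_eq_0_iff_dvd)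
      qed
    qed (use sub that in auto)
    then show ?thesis by blast
  qed
qed

definition inv_subgroups :: "('a, 'b) monoid_scheme \<Rightarrow> ('a \<Rightarrow> 'a) set \<Rightarrow> 'a set \<Rightarrow> 'a set set" where
  "inv_subgroups A \<Omega> V = {U. subgroup U A \<and> U \<subseteq> V \<and> (\<forall>f\<in>\<Omega>. f ` U \<subseteq> U)}"

lemma (in group) mult_inv_cancel [simp]:
  assumes "x \<in> carrier G" "y \<in> carrier G"
  shows "inv x \<otimes> (x \<otimes> y) = y" "x \<otimes> (inv x \<otimes> y) = y"
  using assms by (simp_all add: m_assoc[symmetric])

lemma (in comm_group) acc_operator_step:
  assumes \<Omega>: "\<Omega> \<subseteq> hom G G" and W: "W \<in> inv_subgroups G \<Omega> (carrier G)"
    and acc: "acc_sets (inv_subgroups G \<Omega> W)"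
    and \<sigma>: "\<sigma> \<in> hom G G" and \<tau>: "\<tau> \<in> hom G G"
    and \<tau>\<sigma>: "\<And>x. x \<in> carrier G \<Longrightarrow> \<tau> (\<sigma> x) = x" and \<sigma>\<tau>: "\<And>x. x \<in> carrier G \<Longrightarrow> \<sigma> (\<tau> x) = x"
    and comm: "\<And>f x. f \<in> \<Omega> \<Longrightarrow> x \<in> carrier G \<Longrightarrow> f (\<sigma> x) = \<sigma> (f x)"
  shows "\<exists>V \<in> inv_subgroups G (insert \<sigma> (insert \<tau> \<Omega>)) (carrier G).
    W \<subseteq> V \<and> acc_sets (inv_subgroups G (insert \<sigma> (insert \<tau> \<Omega>)) V)"
proof -
  have \<Omega>_cl: "f x \<in> carrier G" and \<Omega>_mult: "y \<in> carrier G \<Longrightarrow> f (x \<otimes> y) = f x \<otimes> f y"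
    if "f \<in> \<Omega>" "x \<in> carrier G" for f x y
    using \<Omega> that by (auto simp: hom_def)
  have sW: "subgroup W G" and W_inv: "f \<in> \<Omega> \<Longrightarrow> w \<in> W \<Longrightarrow> f w \<in> W" for f w
    using W by (auto simp: inv_subgroups_def)
  have WG: "w \<in> carrier G" if "w \<in> W" for w using subgroup.mem_carrier[OF sW that] .
  interpret \<sigma>: group_hom G G \<sigma> using \<sigma> by unfold_locales
  interpret \<tau>: group_hom G G \<tau> using \<tau> by unfold_locales
  have pow_hom: "\<sigma> ^^ n \<in> hom G G" for n
    by (induction n) (auto simp: hom_def Pi_iff)
  have pow_cl: "(\<sigma> ^^ n) x \<in> carrier G" if "x \<in> carrier G" for n x
    using pow_hom[of n] that by (auto simp: hom_def)
  have pow_mult: "(\<sigma> ^^ n) (x \<otimes> y) = (\<sigma> ^^ n) x \<otimes> (\<sigma> ^^ n) y"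
    if "x \<in> carrier G" "y \<in> carrier G" for n x y
    using pow_hom[of n] that by (auto simp: hom_def)
  have pow_gh: "group_hom G G (\<sigma> ^^ n)" for n
    using pow_hom by unfold_locales
  note pow_one = group_hom.hom_one[OF pow_gh]
  note pow_inv = group_hom.hom_inv[OF pow_gh]
  have pow_comm: "f ((\<sigma> ^^ n) x) = (\<sigma> ^^ n) (f x)" if "f \<in> \<Omega>" "x \<in> carrier G" for f n x
    using that by (induction n) (simp_all add: comm pow_cl)
  have \<tau>_pow: "(\<tau> ^^ n) ((\<sigma> ^^ n) x) = x" if "x \<in> carrier G" for n x
  proof (induction n)
    case (Suc n)
    have "(\<tau> ^^ Suc n) ((\<sigma> ^^ Suc n) x) = (\<tau> ^^ n) (\<tau> (\<sigma> ((\<sigma> ^^ n) x)))"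
      by (simp add: funpow_swap1)
    then show ?case using Suc that pow_cl \<tau>\<sigma> by simp
  qed simp
  define P where "P = rec_nat {\<one>} (\<lambda>n D. D <#> (\<sigma> ^^ n) ` W)"
  have P0: "P 0 = {\<one>}" and PS: "P (Suc n) = P n <#> (\<sigma> ^^ n) ` W" for n
    by (simp_all add: P_def)
  have img: "subgroup ((\<sigma> ^^ n) ` W) G" for n
    using group_hom.subgroup_img_is_subgroup[OF pow_gh sW] .
  have sP: "subgroup (P n) G" for n
    by (induction n) (auto simp: P0 PS triv_subgroup intro: mult_subgroups img)
  have PG: "x \<in> carrier G" if "x \<in> P n" for x n using subgroup.mem_carrier[OF sP that] .
  have P_step: "P n \<subseteq> P (Suc n)" for n
  proof
    fix x assume "x \<in> P n"
    moreover have "\<one> \<in> (\<sigma> ^^ n) ` W" using subgroup.one_closed[OF img] .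
    ultimately have "x \<otimes> \<one> \<in> P (Suc n)"
      unfolding PS set_mult_def by blast
    then show "x \<in> P (Suc n)" using PG[OF \<open>x \<in> P n\<close>] by simp
  qed
  have P_mono: "P m \<subseteq> P n" if "m \<le> n" for m n
    using that by (induction rule: dec_induct) (use P_step in auto)
  have P_\<sigma>: "\<sigma> x \<in> P (Suc n)" if "x \<in> P n" for x n
    using that
  proof (induction n arbitrary: x)
    case 0
    then show ?case using subgroup.one_closed[OF sP] by (simp add: P0)
  next
    case (Suc n)
    then obtain a w where aw: "a \<in> P n" "w \<in> W" "x = a \<otimes> (\<sigma> ^^ n) w"
      by (auto simp: PS set_mult_def)
    have "\<sigma> x = \<sigma> a \<otimes> (\<sigma> ^^ Suc n) w"
      using aw PG WG pow_cl by simp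
    then show ?case using Suc.IH[OF aw(1)] aw(2)
      unfolding PS[of "Suc n"] set_mult_def by blast
  qed
  have P_\<Omega>: "f x \<in> P n" if "x \<in> P n" "f \<in> \<Omega>" for f x n
    using that(1)
  proof (induction n arbitrary: x)
    case 0
    have "f \<one> = \<one>"
      using hom_one[of f G G] that(2) \<Omega> is_group by auto
    then show ?case using 0 by (simp add: P0)
  next
    case (Suc n)
    then obtain a w where aw: "a \<in> P n" "w \<in> W" "x = a \<otimes> (\<sigma> ^^ n) w"
      by (auto simp: PS set_mult_def)
    have "f x = f a \<otimes> (\<sigma> ^^ n) (f w)"
      using \<Omega>_mult[OF that(2) PG[OF aw(1)] pow_cl[OF WG[OF aw(2)]]] pow_comm[OF that(2) WG[OF aw(2)]]
      by (simp add: aw(3))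
    then show ?case using Suc.IH[OF aw(1)] W_inv[OF that(2) aw(2)]
      unfolding PS set_mult_def by blast
  qed
  define V where "V = {v \<in> carrier G. \<exists>j n. (\<sigma> ^^ j) v \<in> P n}"
  have V_later: "\<exists>n. (\<sigma> ^^ (k + j)) v \<in> P n" if "(\<sigma> ^^ j) v \<in> P m" for j k m v
  proof (induction k)
    case (Suc k)
    then show ?case using P_\<sigma> by auto
  qed (use that in auto)
  let ?\<Omega> = "insert \<sigma> (insert \<tau> \<Omega>)"
  have sV: "subgroup V G"
  proof (rule subgroupI)
    show "V \<noteq> {}" using subgroup.one_closed[OF sP[of 0]] by (auto simp: V_def intro!: exI[of _ \<one>] exI[of _ 0])
  next
    fix a assume "a \<in> V"
    then show "inv a \<in> V"
      using subgroup.m_inv_closed[OF sP] by (auto simp: V_def pow_inv)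
  next
    fix a b assume "a \<in> V" "b \<in> V"
    then obtain i j m n where *: "a \<in> carrier G" "b \<in> carrier G" "(\<sigma> ^^ i) a \<in> P m" "(\<sigma> ^^ j) b \<in> P n"
      by (auto simp: V_def)
    obtain m' n' where **: "(\<sigma> ^^ (j + i)) a \<in> P m'" "(\<sigma> ^^ (i + j)) b \<in> P n'"
      using V_later[OF *(3)] V_later[OF *(4)] by blast
    let ?l = "max m' n'"
    have "(\<sigma> ^^ (i + j)) a \<in> P ?l" "(\<sigma> ^^ (i + j)) b \<in> P ?l"
      using ** P_mono[of m' ?l] P_mono[of n' ?l] by (auto simp: add.commute)
    then have "(\<sigma> ^^ (i + j)) (a \<otimes> b) \<in> P ?l"
      using * subgroup.m_closed[OF sP] by (simp add: pow_mult)
    then show "a \<otimes> b \<in> V" using * by (auto simp: V_def)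
  qed (auto simp: V_def)
  have V_\<sigma>: "\<sigma> v \<in> V" if v: "v \<in> V" for v
  proof -
    obtain j n where "(\<sigma> ^^ j) v \<in> P n" "v \<in> carrier G" using v by (auto simp: V_def)
    with P_\<sigma>[of "(\<sigma> ^^ j) v" n] have "\<sigma> v \<in> carrier G" "(\<sigma> ^^ j) (\<sigma> v) \<in> P (Suc n)"
      by (simp_all add: funpow_swap1)
    then show ?thesis unfolding V_def by blast
  qed
  have V_\<tau>: "\<tau> v \<in> V" if v: "v \<in> V" for v
  proof -
    obtain j n where j: "(\<sigma> ^^ j) v \<in> P n" "v \<in> carrier G" using v by (auto simp: V_def)
    then have "(\<sigma> ^^ Suc j) (\<tau> v) \<in> P n" by (simp add: funpow_swap1 \<sigma>\<tau>)
    moreover have "\<tau> v \<in> carrier G" using j by simp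
    ultimately show ?thesis unfolding V_def by blast
  qed
  have V_\<Omega>: "f v \<in> V" if v: "v \<in> V" "f \<in> \<Omega>" for f v
  proof -
    obtain j n where j: "(\<sigma> ^^ j) v \<in> P n" "v \<in> carrier G" using v by (auto simp: V_def)
    then have "(\<sigma> ^^ j) (f v) \<in> P n" using P_\<Omega>[OF j(1) v(2)] pow_comm[OF v(2) j(2)] by simp
    then show ?thesis using j \<Omega>_cl[OF v(2)] unfolding V_def by blast
  qed
  have V_in: "V \<in> inv_subgroups G ?\<Omega> (carrier G)"
    using sV V_\<sigma> V_\<tau> V_\<Omega> subgroup.subset[OF sV] by (auto simp: inv_subgroups_def)
  have WV: "W \<subseteq> V"
  proof
    fix w assume w: "w \<in> W"
    then have "\<one> \<otimes> w \<in> P (Suc 0)" unfolding PS P0 set_mult_def by force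
    then have "w \<in> carrier G" "(\<sigma> ^^ 0) w \<in> P (Suc 0)" using WG[OF w] by simp_all
    then show "w \<in> V" unfolding V_def by blast
  qed
  \<comment> \<open>Leading coefficients, as in Hilbert's basis theorem: \<open>V\<close> plays the role of the Laurent polynomials
    over \<open>W\<close> in the variable \<open>\<sigma>\<close>, and \<open>P n\<close> of the polynomials of degree less than \<open>n\<close>.\<close>
  define lc where "lc n U = {w \<in> W. (\<sigma> ^^ n) w \<in> U <#> P n}" for n U
  have inv_sub: "subgroup U G" "f \<in> ?\<Omega> \<Longrightarrow> u \<in> U \<Longrightarrow> f u \<in> U" "U \<subseteq> V"
    if "U \<in> inv_subgroups G ?\<Omega> V" for U f u
    using that by (auto simp: inv_subgroups_def image_subset_iff)
  have "acc_sets (inv_subgroups G ?\<Omega> V)"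
  proof (rule acc_sets_filtration[OF acc, of _ lc])
    fix U n assume U: "U \<in> inv_subgroups G ?\<Omega> V"
    note sU = inv_sub(1)[OF U]
    note UG = subgroup.mem_carrier[OF sU]
    have sUP: "subgroup (U <#> P n) G" for n using mult_subgroups[OF sU sP] .
    show "lc n U \<in> inv_subgroups G \<Omega> W"
      unfolding inv_subgroups_def
    proof (intro CollectI conjI ballI)
      show "subgroup (lc n U) G"
      proof (rule subgroupI)
        show "lc n U \<noteq> {}"
          using subgroup.one_closed[OF sW] subgroup.one_closed[OF sUP] pow_one
          by (force simp: lc_def)
      qed (use WG subgroup.m_closed[OF sW] subgroup.m_closed[OF sUP] subgroup.m_inv_closed[OF sW]
          subgroup.m_inv_closed[OF sUP] in \<open>auto simp: lc_def pow_inv pow_mult\<close>)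
      fix f assume f: "f \<in> \<Omega>"
      have "f x \<in> U <#> P n" if x: "x \<in> U <#> P n" for x
      proof -
        obtain u v where uv: "u \<in> U" "v \<in> P n" "x = u \<otimes> v" using x by (auto simp: set_mult_def)
        then have "f x = f u \<otimes> f v" using \<Omega>_mult[OF f] UG PG by auto
        moreover have "f u \<in> U" "f v \<in> P n" using uv f P_\<Omega> inv_sub(2)[OF U] by auto
        ultimately show ?thesis unfolding set_mult_def by blast
      qed
      then show "f ` lc n U \<subseteq> lc n U"
        using WG W_inv[OF f] pow_comm[OF f] by (force simp: lc_def)
    qed (auto simp: lc_def)
    show "lc n U \<subseteq> lc (Suc n) U"
    proof
      fix w assume "w \<in> lc n U"
      then obtain u v where w: "w \<in> W" and uv: "u \<in> U" "v \<in> P n" "(\<sigma> ^^ n) w = u \<otimes> v"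
        by (auto simp: set_mult_def lc_def)
      have "(\<sigma> ^^ Suc n) w = \<sigma> u \<otimes> \<sigma> v" using uv UG PG by simp
      moreover have "\<sigma> u \<in> U" "\<sigma> v \<in> P (Suc n)" using uv inv_sub(2)[OF U] P_\<sigma> by auto
      ultimately show "w \<in> lc (Suc n) U" using w unfolding lc_def set_mult_def by blast
    qed
  next
    fix D Y :: "'a set" and n assume "D \<subseteq> Y"
    then show "lc n D \<subseteq> lc n Y" by (auto simp: lc_def set_mult_def)
  next
    fix D Y assume D: "D \<in> inv_subgroups G ?\<Omega> V" and Y: "Y \<in> inv_subgroups G ?\<Omega> V"
      and "D \<subseteq> Y" and eq: "\<And>n. lc n D = lc n Y"
    note sX = inv_sub(1)[OF D] and sY = inv_sub(1)[OF Y]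
    note DG = subgroup.mem_carrier[OF sX] and YG = subgroup.mem_carrier[OF sY]
    have YPX: "y \<in> D" if "y \<in> Y" "y \<in> P n" for y n
      using that
    proof (induction n arbitrary: y)
      case 0
      then show ?case using subgroup.one_closed[OF sX] by (simp add: P0)
    next
      case (Suc n)
      then obtain a w where aw: "a \<in> P n" "w \<in> W" "y = a \<otimes> (\<sigma> ^^ n) w"
        by (auto simp: PS set_mult_def)
      note cl = YG[OF Suc.prems(1)] PG[OF aw(1)] WG[OF aw(2)]
      have "(\<sigma> ^^ n) w = y \<otimes> inv a" using aw cl pow_cl by (simp add: m_ac inv_solve_right)
      moreover have "inv a \<in> P n" using subgroup.m_inv_closed[OF sP aw(1)] .
      ultimately have "w \<in> lc n Y" using Suc.prems(1) aw(2) by (auto simp: lc_def set_mult_def)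
      then have "w \<in> lc n D" by (simp only: eq)
      then obtain x b where xb: "x \<in> D" "b \<in> P n" "(\<sigma> ^^ n) w = x \<otimes> b"
        unfolding lc_def set_mult_def by auto
      note cl' = DG[OF xb(1)] PG[OF xb(2)]
      have "y \<otimes> inv x = a \<otimes> b"
        using aw(3) xb(3) cl cl' by (simp add: m_ac inv_solve_right')
      moreover have "a \<otimes> b \<in> P n" using subgroup.m_closed[OF sP aw(1) xb(2)] .
      moreover have "y \<otimes> inv x \<in> Y"
        using Suc.prems(1) xb(1) \<open>D \<subseteq> Y\<close> subgroup.m_closed[OF sY] subgroup.m_inv_closed[OF sY] by blast
      ultimately have "y \<otimes> inv x \<in> D" using Suc.IH by simp
      then have "y \<otimes> inv x \<otimes> x \<in> D" using subgroup.m_closed[OF sX] xb(1) by blast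
      then show ?case using cl cl' by (simp add: m_assoc)
    qed
    show "Y \<subseteq> D"
    proof
      fix y assume y: "y \<in> Y"
      then obtain j n where j: "(\<sigma> ^^ j) y \<in> P n" using inv_sub(3)[OF Y] by (auto simp: V_def)
      have "(\<sigma> ^^ j) y \<in> Y" using y inv_sub(2)[OF Y] by (induction j) auto
      then have "(\<sigma> ^^ j) y \<in> D" using YPX j by blast
      then have "(\<tau> ^^ k) ((\<sigma> ^^ j) y) \<in> D" for k
        using inv_sub(2)[OF D] by (induction k) auto
      from this[of j] show "y \<in> D" using \<tau>_pow YG[OF y] by simp
    qed
  qed
  with V_in WV show ?thesis by blast
qed

lemma (in comm_group) acc_operators:
  assumes "finite I" and W: "subgroup W G" and acc: "acc_sets (inv_subgroups G {} W)"
    and hom: "\<And>i. i \<in> I \<Longrightarrow> \<sigma> i \<in> hom G G" "\<And>i. i \<in> I \<Longrightarrow> \<tau> i \<in> hom G G"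
    and \<tau>\<sigma>: "\<And>i x. i \<in> I \<Longrightarrow> x \<in> carrier G \<Longrightarrow> \<tau> i (\<sigma> i x) = x"
    and \<sigma>\<tau>: "\<And>i x. i \<in> I \<Longrightarrow> x \<in> carrier G \<Longrightarrow> \<sigma> i (\<tau> i x) = x"
    and comm: "\<And>i f x. i \<in> I \<Longrightarrow> f \<in> \<sigma> ` I \<union> \<tau> ` I \<Longrightarrow> x \<in> carrier G \<Longrightarrow> f (\<sigma> i x) = \<sigma> i (f x)"
  shows "\<exists>V \<in> inv_subgroups G (\<sigma> ` I \<union> \<tau> ` I) (carrier G).
    W \<subseteq> V \<and> acc_sets (inv_subgroups G (\<sigma> ` I \<union> \<tau> ` I) V)"
  using assms
proof (induction I rule: finite_induct)
  case empty
  then show ?case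
    using subgroup.subset[of W G] by (intro bexI[of _ W]) (auto simp: inv_subgroups_def)
next
  case (insert i I)
  have "\<exists>V \<in> inv_subgroups G (\<sigma> ` I \<union> \<tau> ` I) (carrier G).
    W \<subseteq> V \<and> acc_sets (inv_subgroups G (\<sigma> ` I \<union> \<tau> ` I) V)"
    by (rule insert.IH) (use insert.prems in auto)
  then obtain V where V: "V \<in> inv_subgroups G (\<sigma> ` I \<union> \<tau> ` I) (carrier G)" "W \<subseteq> V"
    "acc_sets (inv_subgroups G (\<sigma> ` I \<union> \<tau> ` I) V)" by blast
  have "\<exists>V' \<in> inv_subgroups G (insert (\<sigma> i) (insert (\<tau> i) (\<sigma> ` I \<union> \<tau> ` I))) (carrier G).
    V \<subseteq> V' \<and> acc_sets (inv_subgroups G (insert (\<sigma> i) (insert (\<tau> i) (\<sigma> ` I \<union> \<tau> ` I))) V')"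
    by (rule acc_operator_step[OF _ V(1,3)]) (use insert.prems in auto)
  moreover have "\<sigma> ` insert i I \<union> \<tau> ` insert i I = insert (\<sigma> i) (insert (\<tau> i) (\<sigma> ` I \<union> \<tau> ` I))"
    by auto
  ultimately show ?case using V(2) by (metis subset_trans)
qed

lemma acc_sets_subset: "acc_sets \<B> \<Longrightarrow> \<A> \<subseteq> \<B> \<Longrightarrow> acc_sets \<A>"
  unfolding acc_sets_def by (meson subset_trans)

definition cj :: "('a, 'b) monoid_scheme \<Rightarrow> 'a \<Rightarrow> 'a \<Rightarrow> 'a" where
  "cj G g x = g \<otimes>\<^bsub>G\<^esub> x \<otimes>\<^bsub>G\<^esub> inv\<^bsub>G\<^esub> g"

context group
begin

lemma cj_closed [simp, intro]: "g \<in> carrier G \<Longrightarrow> x \<in> carrier G \<Longrightarrow> cj G g x \<in> carrier G"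
  by (simp add: cj_def)

lemma cj_mult: "g \<in> carrier G \<Longrightarrow> x \<in> carrier G \<Longrightarrow> y \<in> carrier G \<Longrightarrow>
    cj G g (x \<otimes> y) = cj G g x \<otimes> cj G g y"
  by (simp add: cj_def m_assoc inv_solve_left)

lemma cj_one [simp]: "g \<in> carrier G \<Longrightarrow> cj G g \<one> = \<one>"
  by (simp add: cj_def)

lemma cj_one_left [simp]: "x \<in> carrier G \<Longrightarrow> cj G \<one> x = x"
  by (simp add: cj_def)

lemma cj_inv: "g \<in> carrier G \<Longrightarrow> x \<in> carrier G \<Longrightarrow> cj G g (inv x) = inv (cj G g x)"
  by (simp add: cj_def inv_mult_group m_assoc)

lemma cj_cj: "g \<in> carrier G \<Longrightarrow> h \<in> carrier G \<Longrightarrow> x \<in> carrier G \<Longrightarrow>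
    cj G g (cj G h x) = cj G (g \<otimes> h) x"
  by (simp add: cj_def inv_mult_group m_assoc)

lemma cj_inv_cj [simp]:
  assumes "g \<in> carrier G" "x \<in> carrier G"
  shows "cj G (inv g) (cj G g x) = x" "cj G g (cj G (inv g) x) = x"
  using assms by (simp_all add: cj_cj)

lemma cj_hom: "g \<in> carrier G \<Longrightarrow> cj G g \<in> hom G G"
  by (auto simp: hom_def cj_mult)

lemma normal_iff_cj: "N \<lhd> G \<longleftrightarrow> subgroup N G \<and> (\<forall>g\<in>carrier G. \<forall>x\<in>N. cj G g x \<in> N)"
  by (auto simp: normal_inv_iff cj_def)

lemma generate_cj_invariant:
  assumes S: "S \<subseteq> carrier G" and A: "A \<subseteq> carrier G"
    and "\<And>s a. s \<in> S \<Longrightarrow> a \<in> A \<Longrightarrow> cj G s a \<in> A"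
    and "\<And>s a. s \<in> S \<Longrightarrow> a \<in> A \<Longrightarrow> cj G (inv s) a \<in> A"
    and g: "g \<in> generate G S" and "a \<in> A"
  shows "cj G g a \<in> A"
  using g \<open>a \<in> A\<close>
proof (induction g arbitrary: a rule: generate.induct)
  case (eng g h)
  have "cj G (g \<otimes> h) a = cj G g (cj G h a)"
    using eng A generate_in_carrier[OF S] by (subst cj_cj) auto
  then show ?case using eng by simp
qed (use assms in auto)

lemma acc_over_cyclic:
  assumes A: "subgroup A G" and WA: "W \<subseteq> A" and s: "s \<in> carrier G"
    and norm: "\<And>a. a \<in> A \<Longrightarrow> cj G s a \<in> A" "\<And>a. a \<in> A \<Longrightarrow> cj G (inv s) a \<in> A"
    and acc: "acc_sets {U. subgroup U G \<and> W \<subseteq> U \<and> U \<subseteq> A}"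
  shows "acc_sets {U. subgroup U G \<and> W \<subseteq> U \<and> U \<subseteq> generate G (insert s A)}"
proof -
  note AG = subgroup.mem_carrier[OF A]
  have norm_pow: "cj G (s [^] k) a \<in> A" if "a \<in> A" for k :: int and a
  proof (rule generate_cj_invariant[of "{s}" A])
    show "s [^] k \<in> generate G {s}" using generate_pow[OF s] by blast
  qed (use s norm subgroup.subset[OF A] that in auto)
  have swap: "s [^] k \<otimes> a = cj G (s [^] k) a \<otimes> s [^] k" if "a \<in> A" for k :: int and a
    using s AG[OF that] by (simp add: cj_def m_assoc)
  have pow_add: "s [^] k \<otimes> s [^] l = s [^] (k + l)" for k l :: int
    using s by (simp add: int_pow_mult)
  have prod: "(a \<otimes> s [^] k) \<otimes> (b \<otimes> s [^] l) = (a \<otimes> cj G (s [^] k) b) \<otimes> s [^] (k + l)"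
    if "a \<in> A" "b \<in> A" for a b and k l :: int
  proof -
    have "(a \<otimes> s [^] k) \<otimes> (b \<otimes> s [^] l) = a \<otimes> (s [^] k \<otimes> b) \<otimes> s [^] l"
      using s AG that by (simp add: m_assoc)
    also have "\<dots> = a \<otimes> cj G (s [^] k) b \<otimes> (s [^] k \<otimes> s [^] l)"
      unfolding swap[OF that(2)] using s AG that by (simp add: m_assoc)
    finally show ?thesis using pow_add by simp
  qed
  have inv_prod: "inv (a \<otimes> s [^] k) = cj G (s [^] (- k)) (inv a) \<otimes> s [^] (- k)"
    if "a \<in> A" for a and k :: int
    using s AG[OF that] swap[OF subgroup.m_inv_closed[OF A that], of "- k"]
    by (simp add: inv_mult_group int_pow_neg)
  have gen: "\<exists>a\<in>A. \<exists>k :: int. x = a \<otimes> s [^] k" if "x \<in> generate G (insert s A)" for x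
    using that
  proof (induction x rule: generate.induct)
    case one
    then show ?case by (intro bexI[of _ \<one>] exI[of _ 0]) (use subgroup.one_closed[OF A] in auto)
  next
    case (incl h)
    then show ?case
    proof
      assume "h = s"
      then show ?thesis
        by (intro bexI[of _ \<one>] exI[of _ 1]) (use subgroup.one_closed[OF A] s in auto)
    next
      assume "h \<in> A"
      then show ?thesis by (intro bexI[of _ h] exI[of _ 0]) (use AG in auto)
    qed
  next
    case (inv h)
    then show ?case
    proof
      assume "h = s"
      then show ?thesis
        by (intro bexI[of _ \<one>] exI[of _ "- 1"])
          (use subgroup.one_closed[OF A] s in \<open>auto simp: int_pow_neg\<close>)
    next
      assume "h \<in> A"
      then show ?thesis
        by (intro bexI[of _ "inv h"] exI[of _ 0]) (use AG subgroup.m_inv_closed[OF A] in auto)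
    qed
  next
    case (eng g h)
    then show ?case using prod norm_pow subgroup.m_closed[OF A] by metis
  qed
  define J where "J U = {k :: int. \<exists>a\<in>A. a \<otimes> s [^] k \<in> U}" for U
  show ?thesis
  proof (rule acc_sets_pair[OF acc acc_sets_int_subgroups, of _ "\<lambda>U. U \<inter> A" J])
    fix U assume U: "U \<in> {U. subgroup U G \<and> W \<subseteq> U \<and> U \<subseteq> generate G (insert s A)}"
    then have sU: "subgroup U G" by simp
    show "U \<inter> A \<in> {U. subgroup U G \<and> W \<subseteq> U \<and> U \<subseteq> A}"
      using U WA subgroups_Inter_pair[OF sU A] by auto
    show "J U \<in> {J. 0 \<in> J \<and> (\<forall>x\<in>J. \<forall>y\<in>J. x - y \<in> J)}"
    proof (intro CollectI conjI ballI)
      show "0 \<in> J U"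
        using subgroup.one_closed[OF A] subgroup.one_closed[OF sU] by (auto simp: J_def intro!: bexI[of _ \<one>])
      fix k l assume "k \<in> J U" "l \<in> J U"
      then obtain a b where ab: "a \<in> A" "b \<in> A" "a \<otimes> s [^] k \<in> U" "b \<otimes> s [^] l \<in> U"
        by (auto simp: J_def)
      have "(a \<otimes> s [^] k) \<otimes> inv (b \<otimes> s [^] l) \<in> U"
        using ab subgroup.m_closed[OF sU] subgroup.m_inv_closed[OF sU] by blast
      also have "(a \<otimes> s [^] k) \<otimes> inv (b \<otimes> s [^] l) =
          (a \<otimes> cj G (s [^] k) (cj G (s [^] (- l)) (inv b))) \<otimes> s [^] (k + - l)"
        unfolding inv_prod[OF ab(2)]
        by (rule prod) (use ab norm_pow subgroup.m_inv_closed[OF A] in auto)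
      finally show "k - l \<in> J U"
        using ab norm_pow subgroup.m_inv_closed[OF A] subgroup.m_closed[OF A] by (auto simp: J_def)
    qed
  next
    fix U U' assume UU: "U \<in> {U. subgroup U G \<and> W \<subseteq> U \<and> U \<subseteq> generate G (insert s A)}"
      "U' \<in> {U. subgroup U G \<and> W \<subseteq> U \<and> U \<subseteq> generate G (insert s A)}"
      and "U \<subseteq> U'" and eq: "U \<inter> A = U' \<inter> A" "J U = J U'"
    then have sU: "subgroup U G" and sU': "subgroup U' G" and U': "U' \<subseteq> generate G (insert s A)"
      by auto
    show "U' \<subseteq> U"
    proof
      fix x assume x: "x \<in> U'"
      then obtain a k where ak: "a \<in> A" "x = a \<otimes> s [^] (k :: int)" using gen U' by blast
      with x have "k \<in> J U" unfolding eq(2) by (auto simp: J_def)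
      then obtain b where b: "b \<in> A" "b \<otimes> s [^] k \<in> U" unfolding J_def by blast
      have "x \<otimes> inv (b \<otimes> s [^] k) = a \<otimes> inv b"
        using ak b(1) s AG by (simp add: inv_mult_group m_assoc inv_solve_left')
      moreover have "x \<otimes> inv (b \<otimes> s [^] k) \<in> U'"
        using x b \<open>U \<subseteq> U'\<close> subgroup.m_closed[OF sU'] subgroup.m_inv_closed[OF sU'] by blast
      moreover have "a \<otimes> inv b \<in> A"
        using ak b subgroup.m_closed[OF A] subgroup.m_inv_closed[OF A] by blast
      ultimately have "x \<otimes> inv (b \<otimes> s [^] k) \<in> U" using eq(1) by auto
      then have "x \<otimes> inv (b \<otimes> s [^] k) \<otimes> (b \<otimes> s [^] k) \<in> U"
        using b subgroup.m_closed[OF sU] by blast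
      then show "x \<in> U" using subgroup.mem_carrier[OF sU' x] subgroup.mem_carrier[OF sU b(2)]
        by (simp add: m_assoc)
    qed
  qed (auto simp: J_def)
qed

lemma acc_over_fin_gen:
  assumes "subgroup P G" "subgroup W G" "W \<subseteq> P"
    and comm: "\<And>x y. x \<in> P \<Longrightarrow> y \<in> P \<Longrightarrow> cj G x y \<otimes> inv y \<in> W"
    and "finite T" "T \<subseteq> P"
  shows "acc_sets {U. subgroup U G \<and> W \<subseteq> U \<and> U \<subseteq> generate G (W \<union> T)}"
  using \<open>finite T\<close> \<open>T \<subseteq> P\<close>
proof (induction T rule: finite_induct)
  case empty
  have "generate G W = W"
    using generate_subgroup_incl[OF order_refl \<open>subgroup W G\<close>] generate.incl[of _ W G] by blast
  then have *: "{U. subgroup U G \<and> W \<subseteq> U \<and> U \<subseteq> generate G (W \<union> {})} \<subseteq> {W}" by auto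
  show ?case
    by (rule acc_sets_subset[OF _ *]) (simp add: acc_sets_def image_subset_iff)
next
  case (insert s T)
  note PG = subgroup.mem_carrier[OF \<open>subgroup P G\<close>]
  have WT: "W \<union> T \<subseteq> carrier G" using insert.prems \<open>W \<subseteq> P\<close> PG by blast
  let ?A = "generate G (W \<union> T)"
  have A: "subgroup ?A G" using generate_is_subgroup[OF WT] .
  have AP: "?A \<subseteq> P"
    using generate_subgroup_incl[OF _ \<open>subgroup P G\<close>] insert.prems \<open>W \<subseteq> P\<close> by blast
  have norm: "cj G p a \<in> ?A" if "p \<in> P" "a \<in> ?A" for p a
  proof -
    have a: "a \<in> P" using AP that by blast
    then have "cj G p a \<otimes> inv a \<in> ?A" using comm[OF that(1)] generate.incl[of _ "W \<union> T" G] by blast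
    then have "cj G p a \<otimes> inv a \<otimes> a \<in> ?A" using that(2) subgroup.m_closed[OF A] by blast
    then show ?thesis using that(1) a PG by (simp add: m_assoc)
  qed
  have s: "s \<in> P" "inv s \<in> P" using insert.prems subgroup.m_inv_closed[OF \<open>subgroup P G\<close>] by auto
  have "acc_sets {U. subgroup U G \<and> W \<subseteq> U \<and> U \<subseteq> generate G (insert s ?A)}"
    by (rule acc_over_cyclic[OF A]) (use insert s norm PG generate.incl[of _ "W \<union> T" G] in auto)
  moreover have "generate G (W \<union> insert s T) \<subseteq> generate G (insert s ?A)"
    using generate.incl[of _ "W \<union> T" G] by (intro mono_generate) auto
  ultimately show ?case by (elim acc_sets_subset) auto
qed

lemma commutators_in_normal:
  assumes V: "V \<lhd> G" and S: "S \<subseteq> carrier G" "generate G S = carrier G"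
    and comm: "\<And>s t. s \<in> S \<Longrightarrow> t \<in> S \<Longrightarrow> cj G s t \<otimes> inv t \<in> V"
    and "g \<in> carrier G" "h \<in> carrier G"
  shows "cj G g h \<otimes> inv h \<in> V"
proof -
  have sV: "subgroup V G" and cjV: "\<And>g x. g \<in> carrier G \<Longrightarrow> x \<in> V \<Longrightarrow> cj G g x \<in> V"
    using V by (auto simp: normal_iff_cj)
  note Vm = subgroup.m_closed[OF sV] and Vi = subgroup.m_inv_closed[OF sV]
  have mult: "cj G g (h \<otimes> k) \<otimes> inv (h \<otimes> k) \<in> V"
    if "g \<in> carrier G" "h \<in> carrier G" "k \<in> carrier G"
      "cj G g h \<otimes> inv h \<in> V" "cj G g k \<otimes> inv k \<in> V" for g h k
  proof -
    have "cj G g (h \<otimes> k) \<otimes> inv (h \<otimes> k) = (cj G g h \<otimes> inv h) \<otimes> cj G h (cj G g k \<otimes> inv k)"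
      using that by (simp add: cj_mult inv_mult_group) (simp add: cj_def m_assoc)
    then show ?thesis using Vm cjV that by simp
  qed
  have invr: "cj G g (inv h) \<otimes> inv (inv h) \<in> V"
    if "g \<in> carrier G" "h \<in> carrier G" "cj G g h \<otimes> inv h \<in> V" for g h
  proof -
    have "cj G g (inv h) \<otimes> inv (inv h) = cj G (inv h) (inv (cj G g h \<otimes> inv h))"
      using that by (simp add: cj_inv inv_mult_group) (simp add: cj_def m_assoc)
    then show ?thesis using Vi cjV that by simp
  qed
  have gens: "cj G s h \<otimes> inv h \<in> V" if s: "s \<in> S" and "h \<in> carrier G" for s h
  proof -
    have "h \<in> generate G S" using that S by simp
    then show ?thesis
    proof (induction h rule: generate.induct)
      case one
      then show ?case using S s subgroup.one_closed[OF sV] by auto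
    next
      case (eng h k)
      then show ?case using mult[of s h k] S s by auto
    next
      case (inv h)
      then show ?case using invr[of s h] comm[OF s inv] S s by blast
    qed (use S s comm in auto)
  qed
  have "g \<in> generate G S" using assms by simp
  then have "\<forall>h\<in>carrier G. cj G g h \<otimes> inv h \<in> V"
  proof (induction g rule: generate.induct)
    case one
    then show ?case using subgroup.one_closed[OF sV] by auto
  next
    case (inv g)
    show ?case
    proof
      fix h assume h: "h \<in> carrier G"
      have g: "g \<in> carrier G" using inv S by auto
      have "cj G g (cj G (inv g) h) \<otimes> inv (cj G (inv g) h) \<in> V"
        using gens[OF inv, of "cj G (inv g) h"] g h by simp
      then have "inv (h \<otimes> inv (cj G (inv g) h)) \<in> V" using g h Vi by simp
      then show "cj G (inv g) h \<otimes> inv h \<in> V" using g h by (simp add: inv_mult_group)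
    qed
  next
    case (eng g k)
    show ?case
    proof
      fix h assume h: "h \<in> carrier G"
      have g: "g \<in> carrier G" "k \<in> carrier G" using eng S by auto
      have "(cj G g (cj G k h) \<otimes> inv (cj G k h)) \<otimes> (cj G k h \<otimes> inv h) \<in> V"
        using eng g h Vm by auto
      then show "cj G (g \<otimes> k) h \<otimes> inv h \<in> V"
        using g h by (simp add: cj_cj[symmetric] m_assoc inv_solve_left')
    qed
  qed (use gens in auto)
  then show ?thesis using assms by blast
qed

end

section \<open>Coverings by cosets and commutators\<close>

lemma (in group) finite_covering_bounded_index:
  assumes "finite I"
  shows "\<exists>c. \<forall>B T. (\<forall>i\<in>I. subgroup (B i) G \<and> finite (T i) \<and> T i \<subseteq> carrier G \<and> card (T i) \<le> k) \<longrightarrow>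
    carrier G = (\<Union>i\<in>I. T i <#> B i) \<longrightarrow>
    (\<exists>i\<in>I. \<exists>T'. finite T' \<and> card T' \<le> c \<and> T' \<subseteq> carrier G \<and> carrier G = T' <#> B i \<and> T i \<noteq> {})"
  using assms
proof (induction I arbitrary: k rule: finite_induct)
  case empty
  then show ?case by auto
next
  case (insert i I)
  obtain c where "\<forall>B T. (\<forall>j\<in>I. subgroup (B j) G \<and> finite (T j) \<and> T j \<subseteq> carrier G \<and> card (T j) \<le> k + k * k)
      \<longrightarrow> carrier G = (\<Union>j\<in>I. T j <#> B j) \<longrightarrow>
    (\<exists>j\<in>I. \<exists>T'. finite T' \<and> card T' \<le> c \<and> T' \<subseteq> carrier G \<and> carrier G = T' <#> B j \<and> T j \<noteq> {})"
    using insert.IH[of "k + k * k"] by (rule exE)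
  note c = this[THEN spec, THEN spec, THEN mp, THEN mp]
  show ?case
  proof (intro exI[of _ "max k c"] allI impI)
    fix B :: "_ \<Rightarrow> 'a set" and T
    assume BT: "\<forall>j\<in>insert i I. subgroup (B j) G \<and> finite (T j) \<and> T j \<subseteq> carrier G \<and> card (T j) \<le> k"
      and cover: "carrier G = (\<Union>j\<in>insert i I. T j <#> B j)"
    have BG: "x \<in> carrier G" if "x \<in> B j" "j \<in> insert i I" for x j
      using BT subgroup.mem_carrier that by metis
    have TG: "x \<in> carrier G" if "x \<in> T j" "j \<in> insert i I" for x j
      using BT that by blast
    show "\<exists>j\<in>insert i I. \<exists>T'. finite T' \<and> card T' \<le> max k c \<and> T' \<subseteq> carrier G \<and> carrier G = T' <#> B j \<and> T j \<noteq> {}"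
    proof (cases "carrier G \<subseteq> T i <#> B i")
      case True
      moreover have "T i <#> B i \<subseteq> carrier G" using TG BG by (intro set_mult_closed) auto
      ultimately have "carrier G = T i <#> B i" by (rule subset_antisym)
      moreover have "T i \<noteq> {}" using True one_closed by (auto simp: set_mult_def)
      moreover have "finite (T i)" "T i \<subseteq> carrier G" "card (T i) \<le> max k c" using BT by (simp_all add: le_max_iff_disj)
      ultimately show ?thesis by blast
    next
      case False
      then obtain y where y: "y \<in> carrier G" "y \<notin> T i <#> B i" by blast
      define T2 where "T2 j = T j \<union> (\<lambda>(t, u). t \<otimes> inv y \<otimes> u) ` (T i \<times> T j)" for j
      have T2: "finite (T2 j)" "T2 j \<subseteq> carrier G" "card (T2 j) \<le> k + k * k" if "j \<in> I" for j
      proof -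
        have fin: "finite (T i)" "finite (T j)" and card: "card (T i) \<le> k" "card (T j) \<le> k"
          using BT that by auto
        show "finite (T2 j)" using fin by (simp add: T2_def)
        show "T2 j \<subseteq> carrier G" using TG that y by (auto simp: T2_def)
        have "card ((\<lambda>(t, u). t \<otimes> inv y \<otimes> u) ` (T i \<times> T j)) \<le> card (T i \<times> T j)"
          using fin by (intro card_image_le) auto
        also have "\<dots> \<le> k * k" using card by (simp add: card_cartesian_product mult_le_mono)
        finally show "card (T2 j) \<le> k + k * k"
          unfolding T2_def using card card_Un_le[of "T j"] by (meson add_le_mono le_trans)
      qed
      have "carrier G \<subseteq> (\<Union>j\<in>I. T2 j <#> B j)"
      proof
        fix x assume x: "x \<in> carrier G"
        show "x \<in> (\<Union>j\<in>I. T2 j <#> B j)"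
        proof (cases "x \<in> T i <#> B i")
          case False
          then show ?thesis using x cover by (auto simp: T2_def set_mult_def)
        next
          case True
          then obtain t b where tb: "t \<in> T i" "b \<in> B i" "x = t \<otimes> b" by (auto simp: set_mult_def)
          \<comment> \<open>The coset of \<open>B i\<close> through \<open>y\<close> avoids \<open>T i <#> B i\<close>, hence is covered by cosets of the
            other subgroups, and so are its translates.\<close>
          have tG: "t \<in> carrier G" "b \<in> carrier G" using TG BG tb by auto
          have "y \<otimes> b \<notin> T i <#> B i"
          proof
            assume "y \<otimes> b \<in> T i <#> B i"
            then obtain t' b' where tb': "t' \<in> T i" "b' \<in> B i" "y \<otimes> b = t' \<otimes> b'" by (auto simp: set_mult_def)
            have "y = t' \<otimes> (b' \<otimes> inv b)"
              using tb' tG y TG BG by (metis inv_closed insertI1 inv_solve_right m_assoc m_closed)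
            moreover have "b' \<otimes> inv b \<in> B i"
              using BT tb tb' subgroup.m_closed subgroup.m_inv_closed by (metis insertI1)
            ultimately show False using y tb' by (auto simp: set_mult_def)
          qed
          moreover have "y \<otimes> b \<in> carrier G" using y tG by simp
          ultimately obtain j u b' where j: "j \<in> I" "u \<in> T j" "b' \<in> B j" "y \<otimes> b = u \<otimes> b'"
            using cover by (auto simp: set_mult_def)
          have "x = t \<otimes> (inv y \<otimes> (y \<otimes> b))" using tb tG y by simp
          also have "\<dots> = t \<otimes> inv y \<otimes> u \<otimes> b'"
            using j TG BG tG y by (simp add: m_assoc)
          finally show ?thesis using j tb by (force simp: T2_def set_mult_def)
        qed
      qed
      moreover have "(\<Union>j\<in>I. T2 j <#> B j) \<subseteq> carrier G"
      proof (intro UN_least set_mult_closed)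
        fix j assume "j \<in> I"
        then show "T2 j \<subseteq> carrier G" "B j \<subseteq> carrier G" using T2(2) BG by auto
      qed
      ultimately have "\<exists>j\<in>I. \<exists>T'. finite T' \<and> card T' \<le> c \<and> T' \<subseteq> carrier G \<and> carrier G = T' <#> B j \<and> T2 j \<noteq> {}"
        by (intro c ballI conjI T2 subset_antisym) (use BT in \<open>simp_all only: insert_iff simp_thms\<close>)
      moreover have "T j \<noteq> {}" if "T2 j \<noteq> {}" for j using that by (auto simp: T2_def)
      ultimately show ?thesis by (metis insertI2 le_max_iff_disj)
    qed
  qed
qed

lemma (in group) bounded_index_pigeonhole:
  assumes B: "subgroup B G" and T: "finite T" "card T \<le> c" "T \<subseteq> carrier G" "carrier G = T <#> B"
    and f: "\<And>i :: nat. f i \<in> carrier G"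
  obtains i j where "i < j" "j \<le> c" "inv (f i) \<otimes> f j \<in> B"
proof -
  have "\<exists>t\<in>T. \<exists>b\<in>B. f i = t \<otimes> b" for i
    using f[of i] unfolding T(4) by (auto simp: set_mult_def)
  then obtain t b where t: "\<And>i. t i \<in> T" "\<And>i. b i \<in> B" "\<And>i. f i = t i \<otimes> b i" by metis
  have "\<not> inj_on t {..c}"
  proof
    assume "inj_on t {..c}"
    then have "card {..c} \<le> card T" using T t by (intro card_inj_on_le) auto
    then show False using T by simp
  qed
  then obtain i j where "i \<le> c" "j \<le> c" "i \<noteq> j" "t i = t j" by (auto simp: inj_on_def)
  then obtain i j where ij: "i < j" "j \<le> c" "t i = t j"
    by (metis linorder_neqE_nat)
  have G: "t j \<in> carrier G" "b i \<in> carrier G" "b j \<in> carrier G"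
    using t T subgroup.mem_carrier[OF B] by auto
  have "inv (f i) \<otimes> f j = inv (b i) \<otimes> b j"
    unfolding t(3) ij(3) using G by (simp add: inv_mult_group m_assoc)
  then have "inv (f i) \<otimes> f j \<in> B" using t(2) subgroup.m_closed[OF B] subgroup.m_inv_closed[OF B] by simp
  with ij show thesis by (intro that)
qed

text \<open>In additive notation on an abelian normal subgroup, this is the map \<open>x \<mapsto> (g - 1) x\<close>.\<close>

definition comm_map :: "('a, 'b) monoid_scheme \<Rightarrow> 'a \<Rightarrow> 'a \<Rightarrow> 'a" where
  "comm_map G g x = cj G g x \<otimes>\<^bsub>G\<^esub> inv\<^bsub>G\<^esub> x"

lemma (in group) subgroup_nat_pow_closed:
  "subgroup H G \<Longrightarrow> h \<in> H \<Longrightarrow> h [^] (n :: nat) \<in> H"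
  by (induction n) (auto intro: subgroup.one_closed subgroup.m_closed)

locale abelian_normal = group +
  fixes M
  assumes normal_M: "M \<lhd> G" and comm_group_M: "comm_group (G\<lparr>carrier := M\<rparr>)"
    and commutator_in_M: "\<And>g h. g \<in> carrier G \<Longrightarrow> h \<in> carrier G \<Longrightarrow> comm_map G g h \<in> M"
begin

lemma subgroup_M: "subgroup M G"
  using normal_M by (simp add: normal_iff_cj)

lemmas M_carrier = subgroup.mem_carrier[OF subgroup_M]

lemma cj_M: "g \<in> carrier G \<Longrightarrow> x \<in> M \<Longrightarrow> cj G g x \<in> M"
  using normal_M by (simp add: normal_iff_cj)

lemma commute_M: "x \<in> M \<Longrightarrow> y \<in> M \<Longrightarrow> x \<otimes> y = y \<otimes> x"
  using comm_monoid.m_comm[OF comm_group.axioms(1)[OF comm_group_M]] by simp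

lemma cj_M_trivial: "x \<in> M \<Longrightarrow> y \<in> M \<Longrightarrow> cj G x y = y"
  using commute_M[of x y] M_carrier by (simp add: cj_def m_assoc)

lemma cj_commute:
  assumes "g \<in> carrier G" "h \<in> carrier G" "x \<in> M"
  shows "cj G g (cj G h x) = cj G h (cj G g x)"
proof -
  have gh: "g \<otimes> h = comm_map G g h \<otimes> (h \<otimes> g)"
    using assms by (simp add: comm_map_def cj_def m_assoc)
  have c: "comm_map G g h \<in> M" using commutator_in_M assms by simp
  have "cj G g (cj G h x) = cj G (comm_map G g h) (cj G (h \<otimes> g) x)"
    using assms M_carrier c gh by (simp add: cj_cj)
  also have "\<dots> = cj G (h \<otimes> g) x" using cj_M_trivial c cj_M assms by simp
  finally show ?thesis using assms M_carrier by (simp add: cj_cj)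
qed

lemma comm_map_closed: "g \<in> carrier G \<Longrightarrow> x \<in> carrier G \<Longrightarrow> comm_map G g x \<in> carrier G"
  by (simp add: comm_map_def)

lemma comm_map_in_normal:
  assumes "N \<lhd> G" "g \<in> carrier G" "x \<in> N"
  shows "comm_map G g x \<in> N"
  using assms by (auto simp: comm_map_def normal_iff_cj intro: subgroup.m_closed subgroup.m_inv_closed)

lemma comm_map_mult:
  assumes "g \<in> carrier G" "x \<in> M" "y \<in> M"
  shows "comm_map G g (x \<otimes> y) = comm_map G g x \<otimes> comm_map G g y"
proof -
  have "comm_map G g (x \<otimes> y) = cj G g x \<otimes> (cj G g y \<otimes> inv y) \<otimes> inv x"
    using assms M_carrier by (simp add: comm_map_def cj_mult inv_mult_group m_assoc)
  also have "\<dots> = cj G g x \<otimes> (inv x \<otimes> (cj G g y \<otimes> inv y))"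
    using assms M_carrier cj_M commute_M[of "cj G g y \<otimes> inv y" "inv x"]
      subgroup.m_closed[OF subgroup_M] subgroup.m_inv_closed[OF subgroup_M]
    by (simp add: m_assoc)
  finally show ?thesis using assms M_carrier by (simp add: comm_map_def m_assoc)
qed

lemma comm_map_one [simp]: "g \<in> carrier G \<Longrightarrow> comm_map G g \<one> = \<one>"
  by (simp add: comm_map_def)

lemma comm_map_inv:
  assumes "g \<in> carrier G" "x \<in> M"
  shows "comm_map G g (inv x) = inv (comm_map G g x)"
proof -
  have "comm_map G g (inv x) \<otimes> comm_map G g x = \<one>"
    using assms comm_map_mult[of g "inv x" x] subgroup.m_inv_closed[OF subgroup_M] M_carrier by simp
  then show ?thesis
    using assms M_carrier by (intro inv_equality[symmetric]) (auto intro: comm_map_closed)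
qed

lemma comm_map_pow:
  assumes "g \<in> carrier G" "x \<in> M"
  shows "comm_map G g (x [^] (n :: nat)) = comm_map G g x [^] n"
proof (induction n)
  case (Suc n)
  have "x [^] n \<in> M" using subgroup_nat_pow_closed[OF subgroup_M] assms by simp
  then show ?case using Suc assms by (simp add: comm_map_mult)
qed (use assms in simp)

lemma cj_comm_map:
  assumes "g \<in> carrier G" "h \<in> carrier G" "x \<in> M"
  shows "cj G g (comm_map G h x) = comm_map G h (cj G g x)"
  using assms M_carrier cj_commute[of g h x] by (simp add: comm_map_def cj_mult cj_inv)

lemma normal_comm_map_image:
  assumes N: "N \<lhd> G" "N \<subseteq> M" and g: "g \<in> carrier G"
  shows "comm_map G g ` N \<lhd> G"
proof -
  have sN: "subgroup N G" and cjN: "\<And>g x. g \<in> carrier G \<Longrightarrow> x \<in> N \<Longrightarrow> cj G g x \<in> N"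
    using N by (auto simp: normal_iff_cj)
  have NM: "x \<in> M" if "x \<in> N" for x using N that by blast
  show ?thesis
    unfolding normal_iff_cj
  proof (intro conjI ballI subgroupI)
    fix a assume "a \<in> comm_map G g ` N"
    then obtain x where x: "x \<in> N" "a = comm_map G g x" by blast
    then have "inv a = comm_map G g (inv x)" using comm_map_inv g NM by simp
    then show "inv a \<in> comm_map G g ` N" using subgroup.m_inv_closed[OF sN x(1)] by blast
  next
    fix a b assume "a \<in> comm_map G g ` N" "b \<in> comm_map G g ` N"
    then obtain x y where x: "x \<in> N" "a = comm_map G g x" "y \<in> N" "b = comm_map G g y" by blast
    then have "a \<otimes> b = comm_map G g (x \<otimes> y)" using comm_map_mult g NM by simp
    then show "a \<otimes> b \<in> comm_map G g ` N" using subgroup.m_closed[OF sN x(1,3)] by blast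
  next
    fix h a assume h: "h \<in> carrier G" and "a \<in> comm_map G g ` N"
    then obtain x where x: "x \<in> N" "a = comm_map G g x" by blast
    then have "cj G h a = comm_map G g (cj G h x)" using cj_comm_map g h NM by simp
    then show "cj G h a \<in> comm_map G g ` N" using cjN[OF h x(1)] by blast
  qed (use subgroup.one_closed[OF sN] comm_map_closed[OF g] NM M_carrier in auto)
qed

lemma finite_conjugates_bound:
  assumes N: "N \<lhd> G" "N \<subseteq> M" and F: "finite F" "F \<subseteq> carrier G"
  obtains r :: nat where "r > 0"
    "\<And>H. subgroup H G \<Longrightarrow> (\<And>n. n \<in> N \<Longrightarrow> \<exists>h\<in>F. cj G n h \<in> H) \<Longrightarrow>
      \<exists>h\<in>F. (\<forall>x \<in> comm_map G h ` N. x [^] r \<in> H \<and> comm_map G (h [^] r) x \<in> H)"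
proof -
  have sN: "subgroup N G" and cjN: "\<And>g x. g \<in> carrier G \<Longrightarrow> x \<in> N \<Longrightarrow> cj G g x \<in> N"
    using N by (auto simp: normal_iff_cj)
  have NM: "x \<in> M" if "x \<in> N" for x using N that by blast
  have NG: "x \<in> carrier G" if "x \<in> N" for x using NM M_carrier that by blast
  have FG: "h \<in> carrier G" if "h \<in> F" for h using F that by blast
  let ?N = "G\<lparr>carrier := N\<rparr>"
  interpret GN: group ?N using subgroup.subgroup_is_group[OF sN is_group] .
  have "\<exists>c. \<forall>B T. (\<forall>h\<in>F. subgroup (B h) ?N \<and> finite (T h) \<and> T h \<subseteq> N \<and> card (T h) \<le> Suc 0) \<longrightarrow>
    N = (\<Union>h\<in>F. T h <#> B h) \<longrightarrow>
    (\<exists>h\<in>F. \<exists>T'. finite T' \<and> card T' \<le> c \<and> T' \<subseteq> N \<and> N = T' <#> B h \<and> T h \<noteq> {})"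
    using GN.finite_covering_bounded_index[OF F(1), of "Suc 0"] by simp
  then obtain c where "\<forall>B T. (\<forall>h\<in>F. subgroup (B h) ?N \<and> finite (T h) \<and> T h \<subseteq> N \<and> card (T h) \<le> Suc 0) \<longrightarrow>
    N = (\<Union>h\<in>F. T h <#> B h) \<longrightarrow>
    (\<exists>h\<in>F. \<exists>T'. finite T' \<and> card T' \<le> c \<and> T' \<subseteq> N \<and> N = T' <#> B h \<and> T h \<noteq> {})"
    by (rule exE)
  note c = this[THEN spec, THEN spec, THEN mp, THEN mp]
  show thesis
  proof (rule that[of "fact c"])
    fix H assume H: "subgroup H G" and cover: "\<And>n. n \<in> N \<Longrightarrow> \<exists>h\<in>F. cj G n h \<in> H"
    note Hm = subgroup.m_closed[OF H] and Hi = subgroup.m_inv_closed[OF H]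
    define B where "B h = {n \<in> N. comm_map G h n \<in> H}" for h
    have sB: "subgroup (B h) ?N" if "h \<in> F" for h
    proof -
      have "subgroup (B h) G"
      proof (rule subgroupI)
        show "B h \<noteq> {}" using subgroup.one_closed[OF sN] subgroup.one_closed[OF H] FG[OF that]
          by (auto simp: B_def intro!: exI[of _ \<one>])
      qed (use FG[OF that] NM NG subgroup.m_closed[OF sN] subgroup.m_inv_closed[OF sN] Hm Hi in
          \<open>auto simp: B_def comm_map_mult comm_map_inv\<close>)
      then show ?thesis using subgroup_incl[OF _ sN] by (auto simp: B_def)
    qed
    define T where "T h = (if \<exists>n\<in>N. cj G n h \<in> H then {SOME n. n \<in> N \<and> cj G n h \<in> H} else {})" for h
    have T: "T h = {} \<or> (\<exists>n. n \<in> N \<and> cj G n h \<in> H \<and> T h = {n})" for h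
      using someI_ex[of "\<lambda>n. n \<in> N \<and> cj G n h \<in> H"] by (auto simp: T_def)
    have "N \<subseteq> (\<Union>h\<in>F. T h <#> B h)"
    proof
      fix n assume n: "n \<in> N"
      then obtain h where h: "h \<in> F" "cj G n h \<in> H" using cover by blast
      then have "T h \<noteq> {}" using n by (auto simp: T_def)
      then obtain m where m: "m \<in> N" "cj G m h \<in> H" "T h = {m}" using T by blast
      let ?d = "inv m \<otimes> n"
      have d: "?d \<in> N" using n m subgroup.m_closed[OF sN] subgroup.m_inv_closed[OF sN] by blast
      \<comment> \<open>The quotient of the conjugates of \<open>h\<close> by \<open>m\<close> and \<open>n\<close> is the image of \<open>n - m\<close> under \<open>h - 1\<close>.\<close>
      have "cj G m h \<otimes> inv (cj G n h) \<in> H" using h m Hm Hi by blast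
      moreover have "cj G m h \<otimes> inv (cj G n h) = comm_map G h ?d"
      proof -
        have "cj G m h \<otimes> inv (cj G n h) = m \<otimes> (cj G h ?d \<otimes> inv n)"
          using n m(1) FG[OF h(1)] NG by (simp add: cj_def inv_mult_group m_assoc)
        also have "\<dots> = (cj G h ?d \<otimes> inv n) \<otimes> m"
          using n m(1) NM d cjN[OF FG[OF h(1)] d] subgroup.m_closed[OF sN] subgroup.m_inv_closed[OF sN]
          by (intro commute_M) auto
        also have "\<dots> = comm_map G h ?d"
          using n m(1) FG[OF h(1)] NG NG[OF d] by (simp add: comm_map_def inv_mult_group m_assoc)
        finally show ?thesis .
      qed
      ultimately have "?d \<in> B h" using d by (simp add: B_def)
      moreover have "n = m \<otimes> ?d" using n m NG by simp
      ultimately show "n \<in> (\<Union>h\<in>F. T h <#> B h)" using h m by (force simp: set_mult_def)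
    qed
    moreover have "(\<Union>h\<in>F. T h <#> B h) \<subseteq> N"
      using T subgroup.m_closed[OF sN] by (force simp: set_mult_def B_def)
    ultimately have "\<exists>h\<in>F. \<exists>T'. finite T' \<and> card T' \<le> c \<and> T' \<subseteq> N \<and> N = T' <#> B h \<and> T h \<noteq> {}"
    proof (intro c ballI conjI sB equalityI)
      show "finite (T h)" "T h \<subseteq> N" "card (T h) \<le> Suc 0" for h using T[of h] by auto
    qed
    then obtain h T' where h: "h \<in> F" "T h \<noteq> {}"
      and T': "finite T'" "card T' \<le> c" "T' \<subseteq> N" "N = T' <#> B h"
      by blast
    then obtain m where m: "m \<in> N" "cj G m h \<in> H" using T by blast
    note hG = FG[OF h(1)]
    have "x [^] (fact c :: nat) \<in> H \<and> comm_map G (h [^] (fact c :: nat)) x \<in> H"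
      if "x \<in> comm_map G h ` N" for x
    proof -
      obtain n where n: "n \<in> N" "x = comm_map G h n" using \<open>x \<in> comm_map G h ` N\<close> by blast
      have x: "x \<in> N" using n comm_map_in_normal[OF N(1) hG] by simp
      have pig: "\<exists>i j. i < j \<and> j \<le> c \<and> inv (f i) \<otimes> f j \<in> B h" if f: "\<And>i. f i \<in> N" for f :: "nat \<Rightarrow> 'a"
      proof -
        obtain i j where "i < j" "j \<le> c" "inv\<^bsub>?N\<^esub> (f i) \<otimes> f j \<in> B h"
          by (rule GN.bounded_index_pigeonhole[OF sB[OF h(1)] T'(1,2), of f]) (use T' f in auto)
        then show ?thesis using m_inv_consistent[OF sN f] by auto
      qed
      have dvd: "(j - i) dvd fact c" if "i < j" "j \<le> c" for i j using that by (intro dvd_fact) auto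
      have powN: "n [^] k \<in> N" for k :: nat
        using subgroup_nat_pow_closed[OF sN] n by simp
      have "x [^] (fact c :: nat) \<in> H"
      proof -
        obtain i j where ij: "i < j" "j \<le> c" "inv (n [^] i) \<otimes> n [^] j \<in> B h" using pig[of "\<lambda>i. n [^] i"] powN by blast
        then obtain e where e: "fact c = (j - i) * e" using dvd by blast
        have "n [^] j = n [^] i \<otimes> n [^] (j - i)" using ij n NG by (simp add: nat_pow_mult)
        then have "n [^] (j - i) \<in> B h" using ij n NG by (simp add: m_assoc[symmetric])
        then have "x [^] (j - i) \<in> H" using n hG NM by (simp add: B_def comm_map_pow)
        then have "(x [^] (j - i)) [^] e \<in> H"
          using subgroup_nat_pow_closed[OF H] by simp
        then show ?thesis using x NG by (simp add: e nat_pow_pow)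
      qed
      moreover have "comm_map G (h [^] (fact c :: nat)) x \<in> H"
      proof -
        have hp: "h [^] k \<in> carrier G" for k :: nat using hG by simp
        have cjx: "cj G (h [^] k) x = comm_map G h (cj G (h [^] k) n)" for k :: nat
          unfolding n(2) using cj_comm_map[OF hp hG] n NM by blast
        \<comment> \<open>\<open>h\<close> and its conjugate in \<open>H\<close> act in the same way on \<open>M\<close>, so \<open>H \<inter> M\<close> is invariant under \<open>h\<close>.\<close>
        have inv_h: "cj G (h [^] k) y \<in> H \<and> cj G (inv (h [^] k)) y \<in> H" if y: "y \<in> H" "y \<in> M" for k :: nat and y
        proof -
          let ?h = "cj G m h"
          have hom: "cj G m (h [^] k) = ?h [^] k"
            using hom_nat_pow[OF cj_hom hG is_group is_group, of m k] m NG by simp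
          have same: "cj G (cj G m g) z = cj G g z" if "g \<in> carrier G" "z \<in> M" for g z
          proof -
            have "cj G (cj G m g) z = cj G m (cj G g (cj G (inv m) z))"
              using that m NG M_carrier by (simp add: cj_cj) (simp add: cj_def m_assoc)
            also have "\<dots> = cj G g z"
              using that m NM cj_M_trivial cj_M subgroup.m_inv_closed[OF subgroup_M] by simp
            finally show ?thesis .
          qed
          have hk: "?h [^] k \<in> H"
            using subgroup_nat_pow_closed[OF H] m by simp
          have "cj G (h [^] k) y = cj G (?h [^] k) y" using same[of "h [^] k" y] hG y hom by simp
          moreover have "cj G (inv (h [^] k)) y = cj G (inv (?h [^] k)) y"
            using same[of "inv (h [^] k)" y] hG y hom m NG by (simp add: cj_inv)
          ultimately show ?thesis using hk y Hm Hi by (simp add: cj_def)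
        qed
        obtain i j where ij: "i < j" "j \<le> c" "inv (cj G (h [^] i) n) \<otimes> cj G (h [^] j) n \<in> B h"
          using pig[of "\<lambda>i. cj G (h [^] i) n"] cjN hp n by blast
        then obtain e where e: "fact c = (j - i) * e" using dvd by blast
        let ?k = "h [^] (j - i)"
        have k: "?k \<in> carrier G" using hG by simp
        have nM: "cj G (h [^] l) n \<in> M" for l :: nat using cj_M hp n NM by simp
        have "comm_map G h (inv (cj G (h [^] i) n) \<otimes> cj G (h [^] j) n) \<in> H" using ij by (simp add: B_def)
        then have *: "inv (cj G (h [^] i) x) \<otimes> cj G (h [^] j) x \<in> H"
          unfolding cjx using nM hG subgroup.m_inv_closed[OF subgroup_M] by (simp add: comm_map_mult comm_map_inv)
        have hij: "h [^] j = h [^] i \<otimes> ?k" using ij hG by (simp add: nat_pow_mult)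
        have "inv (cj G (h [^] i) x) \<otimes> cj G (h [^] j) x = cj G (h [^] i) (inv x \<otimes> cj G ?k x)"
          unfolding hij using x NG hp by (simp add: cj_cj[symmetric] cj_mult cj_inv)
        also have "inv x \<otimes> cj G ?k x = comm_map G ?k x"
          unfolding comm_map_def using x NM cj_M k subgroup.m_inv_closed[OF subgroup_M] by (intro commute_M) auto
        finally have "cj G (h [^] i) (comm_map G ?k x) \<in> H" using * by simp
        moreover have kM: "comm_map G ?k x \<in> M" using comm_map_in_normal[OF normal_M k] x NM by simp
        ultimately have "cj G (inv (h [^] i)) (cj G (h [^] i) (comm_map G ?k x)) \<in> H"
          using inv_h cj_M hp by blast
        then have base: "comm_map G ?k x \<in> H" using kM M_carrier hp by simp
        have "comm_map G (?k [^] e) x \<in> H"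
        proof (induction e)
          case 0
          then show ?case using x NG subgroup.one_closed[OF H] by (simp add: comm_map_def)
        next
          case (Suc e)
          have "comm_map G (?k [^] Suc e) x = cj G (?k [^] e) (comm_map G ?k x) \<otimes> comm_map G (?k [^] e) x"
            using x NG k by (simp add: comm_map_def cj_mult cj_inv cj_cj[symmetric] m_assoc)
          moreover have "cj G (?k [^] e) (comm_map G ?k x) \<in> H"
            using inv_h[OF base kM, of "(j - i) * e"] hG by (simp add: nat_pow_pow)
          ultimately show ?case using Suc Hm by simp
        qed
        then show ?thesis using hG by (simp add: e nat_pow_pow)
      qed
      ultimately show ?thesis ..
    qed
    then show "\<exists>h\<in>F. \<forall>x\<in>comm_map G h ` N. x [^] (fact c :: nat) \<in> H \<and> comm_map G (h [^] (fact c :: nat)) x \<in> H"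
      using h(1) by blast
  qed simp
qed

end

section \<open>Uniform normal subgroups\<close>

lemma (in group) normal_Int: "A \<lhd> G \<Longrightarrow> B \<lhd> G \<Longrightarrow> A \<inter> B \<lhd> G"
  by (simp add: normal_iff_cj subgroups_Inter_pair)

lemma (in group) cj_pow: "g \<in> carrier G \<Longrightarrow> x \<in> carrier G \<Longrightarrow> cj G g (x [^] (n :: nat)) = cj G g x [^] n"
  using hom_nat_pow[OF cj_hom _ is_group is_group] by blast

lemma (in abelian_normal) pow_mult_M: "x \<in> M \<Longrightarrow> y \<in> M \<Longrightarrow> (x \<otimes> y) [^] (n :: nat) = x [^] n \<otimes> y [^] n"
  using M_carrier commute_M by (intro pow_mult_distrib) auto

lemma (in abelian_normal) normal_pow_image:
  assumes K: "K \<lhd> G" "K \<subseteq> M"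
  shows "(\<lambda>x. x [^] (n :: nat)) ` K \<lhd> G"
proof -
  have sK: "subgroup K G" and cjK: "\<And>g x. g \<in> carrier G \<Longrightarrow> x \<in> K \<Longrightarrow> cj G g x \<in> K"
    using K by (auto simp: normal_iff_cj)
  have KM: "x \<in> M" "x \<in> carrier G" if "x \<in> K" for x using K that M_carrier by auto
  show ?thesis
    unfolding normal_iff_cj
  proof (intro conjI ballI subgroupI)
    fix a assume "a \<in> (\<lambda>x. x [^] n) ` K"
    then obtain x where x: "x \<in> K" "a = x [^] n" by blast
    then have "inv a = (inv x) [^] n" using nat_pow_inv KM by simp
    then show "inv a \<in> (\<lambda>x. x [^] n) ` K" using subgroup.m_inv_closed[OF sK x(1)] by blast
  next
    fix a b assume "a \<in> (\<lambda>x. x [^] n) ` K" "b \<in> (\<lambda>x. x [^] n) ` K"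
    then obtain x y where x: "x \<in> K" "a = x [^] n" "y \<in> K" "b = y [^] n" by blast
    then have "a \<otimes> b = (x \<otimes> y) [^] n" using pow_mult_M KM by simp
    then show "a \<otimes> b \<in> (\<lambda>x. x [^] n) ` K" using subgroup.m_closed[OF sK x(1,3)] by blast
  next
    fix h a assume h: "h \<in> carrier G" and "a \<in> (\<lambda>x. x [^] n) ` K"
    then obtain x where x: "x \<in> K" "a = x [^] n" by blast
    then have "cj G h a = (cj G h x) [^] n" using cj_pow h KM by simp
    then show "cj G h a \<in> (\<lambda>x. x [^] n) ` K" using cjK[OF h x(1)] by blast
  qed (use subgroup.one_closed[OF sK] KM in auto)
qed

lemma (in group) normal_nontrivial: "K \<lhd> G \<Longrightarrow> K \<noteq> {\<one>} \<longleftrightarrow> (\<exists>x\<in>K. x \<noteq> \<one>)"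
  using subgroup.one_closed by (auto simp: normal_iff_cj)

theorem (in abelian_normal) acc_normal_subgroups:
  assumes S: "finite S" "S \<subseteq> carrier G" "generate G S = carrier G"
  shows "acc_sets {U. U \<lhd> G \<and> U \<subseteq> M}"
proof -
  interpret A: comm_group "G\<lparr>carrier := M\<rparr>" by (rule comm_group_M)
  let ?A = "G\<lparr>carrier := M\<rparr>"
  have comm: "cj G g h \<otimes> inv h \<in> M" if "g \<in> carrier G" "h \<in> carrier G" for g h
    using commutator_in_M that by (simp add: comm_map_def)
  define C where "C = (\<lambda>(s, t). cj G s t \<otimes> inv t) ` (S \<times> S)"
  have C: "finite C" "C \<subseteq> M" using S comm by (auto simp: C_def subset_iff)
  let ?W = "generate ?A ({\<one>} \<union> C)"
  have "acc_sets {U. subgroup U ?A \<and> {\<one>} \<subseteq> U \<and> U \<subseteq> ?W}"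
  proof (rule A.acc_over_fin_gen)
    show "subgroup M ?A" using A.subgroup_self by simp
    show "subgroup {\<one>} ?A" using A.triv_subgroup by simp
    show "cj ?A x y \<otimes>\<^bsub>?A\<^esub> inv\<^bsub>?A\<^esub> y \<in> {\<one>}" if "x \<in> M" "y \<in> M" for x y
      using that A.m_comm[of x y] A.inv_closed[of x] A.m_assoc[of y x "inv\<^bsub>?A\<^esub> x"] A.r_inv[of x]
        A.r_inv[of y] A.r_one[of y]
      by (simp add: cj_def del: A.r_inv A.r_one A.mult_inv_cancel)
  qed (use C subgroup.one_closed[OF subgroup_M] in auto)
  moreover have "inv_subgroups ?A {} ?W \<subseteq> {U. subgroup U ?A \<and> {\<one>} \<subseteq> U \<and> U \<subseteq> ?W}"
    using subgroup.one_closed[of _ ?A] by (auto simp: inv_subgroups_def)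
  ultimately have "acc_sets (inv_subgroups ?A {} ?W)" by (rule acc_sets_subset)
  moreover have W: "subgroup ?W ?A"
    using A.generate_is_subgroup C subgroup.one_closed[OF subgroup_M] by auto
  moreover have hom: "cj G s \<in> hom ?A ?A" if "s \<in> carrier G" for s
    using that cj_M M_carrier by (auto simp: hom_def cj_mult)
  moreover have SG: "s \<in> carrier G" if "s \<in> S" for s using S that by auto
  let ?\<Omega> = "cj G ` S \<union> (\<lambda>s. cj G (inv s)) ` S"
  have "\<exists>V \<in> inv_subgroups ?A ?\<Omega> (carrier ?A). ?W \<subseteq> V \<and> acc_sets (inv_subgroups ?A ?\<Omega> V)"
    by (rule A.acc_operators[OF \<open>finite S\<close> W]) (use calculation SG M_carrier cj_commute in auto)
  then obtain V where V: "V \<in> inv_subgroups ?A ?\<Omega> M" "?W \<subseteq> V" "acc_sets (inv_subgroups ?A ?\<Omega> V)"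
    by auto
  have sV: "subgroup V G" and VM: "V \<subseteq> M"
    using V(1) incl_subgroup[OF subgroup_M] by (auto simp: inv_subgroups_def)
  have "V \<lhd> G"
    unfolding normal_iff_cj
  proof (intro conjI ballI)
    fix g x assume "g \<in> carrier G" "x \<in> V"
    then show "cj G g x \<in> V"
      using S VM M_carrier V(1)
      by (intro generate_cj_invariant[of S V g x]) (auto simp: inv_subgroups_def image_subset_iff)
  qed fact
  have "cj G s t \<otimes> inv t \<in> V" if "s \<in> S" "t \<in> S" for s t
    using that V(2) generate.incl[of _ "{\<one>} \<union> C" ?A] by (auto simp: C_def)
  then have comm': "cj G g h \<otimes> inv h \<in> V" if "g \<in> carrier G" "h \<in> carrier G" for g h
    using commutators_in_normal[OF \<open>V \<lhd> G\<close> S(2,3)] that by blast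
  have acc': "acc_sets {U. subgroup U G \<and> V \<subseteq> U \<and> U \<subseteq> generate G (V \<union> S)}"
    by (rule acc_over_fin_gen[OF subgroup_self sV]) (use S comm' M_carrier VM in auto)
  have gen: "generate G (V \<union> S) = carrier G"
    using mono_generate[of S "V \<union> S"] S generate_incl[of "V \<union> S"] subgroup.subset[OF sV] by auto
  show ?thesis
  proof (rule acc_sets_pair[OF V(3) acc', of _ "\<lambda>U. U \<inter> V" "\<lambda>U. U <#> V"])
    fix U assume "U \<in> {U. U \<lhd> G \<and> U \<subseteq> M}"
    then have U: "subgroup U G" "\<And>g x. g \<in> carrier G \<Longrightarrow> x \<in> U \<Longrightarrow> cj G g x \<in> U" "U \<subseteq> M"
      by (auto simp: normal_iff_cj)
    have "subgroup (U \<inter> V) ?A"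
      using subgroup_incl[OF subgroups_Inter_pair[OF U(1) sV] subgroup_M] U(3) by blast
    then show "U \<inter> V \<in> inv_subgroups ?A ?\<Omega> V"
      using V(1) U SG by (auto simp: inv_subgroups_def image_subset_iff)
    have "subgroup (U <#> V) G"
      using mult_norm_subgroup[OF \<open>V \<lhd> G\<close> U(1)] commut_normal[OF U(1) \<open>V \<lhd> G\<close>] by simp
    moreover have "V \<subseteq> U <#> V"
      using subgroup.one_closed[OF U(1)] subgroup.mem_carrier[OF sV] by (force simp: set_mult_def)
    ultimately show "U <#> V \<in> {U. subgroup U G \<and> V \<subseteq> U \<and> U \<subseteq> generate G (V \<union> S)}"
      using gen subgroup.subset[of "U <#> V" G] by auto
  next
    fix U U' assume *: "U \<in> {U. U \<lhd> G \<and> U \<subseteq> M}" "U' \<in> {U. U \<lhd> G \<and> U \<subseteq> M}" "U \<subseteq> U'"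
      and eq: "U \<inter> V = U' \<inter> V" "U <#> V = U' <#> V"
    then have sU: "subgroup U G" and sU': "subgroup U' G" by (auto simp: normal_iff_cj)
    show "U' \<subseteq> U"
    proof
      fix x assume x: "x \<in> U'"
      have xG: "x \<in> carrier G" using subgroup.mem_carrier[OF sU' x] .
      have "x \<otimes> \<one> \<in> U' <#> V" using x subgroup.one_closed[OF sV] unfolding set_mult_def by blast
      then obtain u v where uv: "u \<in> U" "v \<in> V" "x = u \<otimes> v"
        unfolding eq(2)[symmetric] using xG by (auto simp: set_mult_def)
      have "inv u \<otimes> x \<in> U'"
        using uv x * subgroup.m_closed[OF sU'] subgroup.m_inv_closed[OF sU'] by blast
      moreover have "inv u \<otimes> x = v"
        using uv subgroup.mem_carrier[OF sU] subgroup.mem_carrier[OF sV]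
        by (simp add: m_assoc[symmetric])
      ultimately have "v \<in> U" using uv(2) eq(1) by auto
      then show "x \<in> U" using uv subgroup.m_closed[OF sU] by simp
    qed
  qed (auto simp: set_mult_def)
qed

locale uniform_extension = abelian_normal +
  fixes N
  assumes normal_N: "N \<lhd> G" and N_subset: "N \<subseteq> M"
    and uniform: "\<And>A B. A \<lhd> G \<Longrightarrow> B \<lhd> G \<Longrightarrow> A \<subseteq> N \<Longrightarrow> B \<subseteq> N \<Longrightarrow> A \<noteq> {\<one>} \<Longrightarrow> B \<noteq> {\<one>} \<Longrightarrow> A \<inter> B \<noteq> {\<one>}"
    and centralizer: "\<And>g. g \<in> carrier G \<Longrightarrow> (\<And>x. x \<in> N \<Longrightarrow> cj G g x = x) \<Longrightarrow> g \<in> M"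
    and root_closed: "\<And>g n. g \<in> carrier G \<Longrightarrow> n > (0 :: nat) \<Longrightarrow> g [^] n \<in> M \<Longrightarrow> g \<in> M"
begin

lemma subgroup_N: "subgroup N G"
  using normal_N by (simp add: normal_iff_cj)

lemma N_in: "x \<in> N \<Longrightarrow> x \<in> M" "x \<in> N \<Longrightarrow> x \<in> carrier G"
  using N_subset M_carrier by auto

lemma finite_Inter_nontrivial:
  assumes "finite F" "N \<noteq> {\<one>}"
    and "\<And>h. h \<in> F \<Longrightarrow> K h \<lhd> G \<and> K h \<subseteq> N \<and> K h \<noteq> {\<one>}"
  shows "N \<inter> (\<Inter>h\<in>F. K h) \<lhd> G \<and> N \<inter> (\<Inter>h\<in>F. K h) \<noteq> {\<one>}"
  using assms
proof (induction F rule: finite_induct)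
  case empty
  then show ?case using normal_N by simp
next
  case (insert h F)
  have IH: "N \<inter> (\<Inter>h\<in>F. K h) \<lhd> G" "N \<inter> (\<Inter>h\<in>F. K h) \<noteq> {\<one>}"
    using insert.IH insert.prems by auto
  have *: "N \<inter> (\<Inter>h\<in>insert h F. K h) = K h \<inter> (N \<inter> (\<Inter>h\<in>F. K h))" by auto
  show ?case
    unfolding * using insert.prems(2)[of h] normal_Int[OF _ IH(1)] uniform[OF _ IH(1) _ _ _ IH(2)] by blast
qed

lemma comm_map_eq_one:
  assumes "g \<in> carrier G" "x \<in> carrier G" "comm_map G g x = \<one>"
  shows "cj G g x = x"
proof -
  have "cj G g x = comm_map G g x \<otimes> x" using assms(1,2) by (simp add: comm_map_def m_assoc)
  then show ?thesis using assms by simp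
qed

lemma torsion_normal_bounded:
  assumes acc: "acc_sets {U. U \<lhd> G \<and> U \<subseteq> M}"
    and K: "K \<lhd> G" "K \<subseteq> N" "K \<noteq> {\<one>}" and r: "r > (0 :: nat)" "\<And>x. x \<in> K \<Longrightarrow> x [^] r = \<one>"
  shows "\<exists>R > (0 :: nat). \<forall>x\<in>N. x [^] R = \<one>"
proof -
  note Nm = subgroup.m_closed[OF subgroup_N] and Ni = subgroup.m_inv_closed[OF subgroup_N]
    and N1 = subgroup.one_closed[OF subgroup_N]
  define U where "U i = {x \<in> N. x [^] (r ^ i) = \<one>}" for i
  have U: "U i \<lhd> G" for i
    unfolding normal_iff_cj
  proof (intro conjI ballI subgroupI)
    fix g x assume "g \<in> carrier G" "x \<in> U i"
    then show "cj G g x \<in> U i"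
      using normal_N N_in by (auto simp: U_def cj_pow[symmetric] normal_iff_cj)
  qed (use N_in Nm Ni N1 in \<open>auto simp: U_def nat_pow_inv pow_mult_M intro!: exI[of _ \<one>]\<close>)
  have "mono U"
    using N_in by (intro monoI) (auto simp: U_def le_iff_add power_add nat_pow_pow[symmetric])
  then obtain n where n: "\<And>k. k \<ge> n \<Longrightarrow> U k = U n"
    by (rule acc_setsD[OF acc]) (use U N_subset in \<open>auto simp: U_def\<close>)
  let ?w = "r ^ Suc n"
  let ?B = "(\<lambda>x. x [^] ?w) ` N"
  have "K \<subseteq> U (Suc n)"
    using K r N_in by (auto simp: U_def nat_pow_pow[symmetric] subset_iff)
  then have A: "U (Suc n) \<noteq> {\<one>}" using K by (auto simp: normal_nontrivial U)
  have "U (Suc n) \<inter> ?B \<subseteq> {\<one>}"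
  proof
    fix y assume y: "y \<in> U (Suc n) \<inter> ?B"
    then obtain x where x: "x \<in> N" "y = x [^] ?w" by blast
    have "(x [^] ?w) [^] ?w = \<one>" using y x by (simp add: U_def)
    then have "x [^] (r ^ (Suc n + Suc n)) = \<one>"
      using x N_in unfolding power_add by (simp only: nat_pow_pow)
    then have "x \<in> U (Suc n + Suc n)" using x by (simp add: U_def)
    then have "x \<in> U (Suc n)" using n[of "Suc n + Suc n"] n[of "Suc n"] by simp
    then show "y \<in> {\<one>}" using x by (simp add: U_def)
  qed
  moreover have B: "?B \<lhd> G" using normal_pow_image normal_N N_subset .
  ultimately have "U (Suc n) \<inter> ?B = {\<one>}"
    using U subgroup.one_closed[of _ G] by (auto simp: normal_iff_cj)
  then have "?B = {\<one>}"
    using uniform[OF U B _ _ A] subgroup_nat_pow_closed[OF subgroup_N] by (auto simp: U_def)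
  then show ?thesis using r by (intro exI[of _ ?w]) auto
qed

lemma centralizer_torsion_normal:
  assumes acc: "acc_sets {U. U \<lhd> G \<and> U \<subseteq> M}"
    and K: "K \<lhd> G" "K \<subseteq> N" "K \<noteq> {\<one>}" and r: "r > (0 :: nat)" "\<And>x. x \<in> K \<Longrightarrow> x [^] r = \<one>"
    and u: "u \<in> carrier G" "\<And>x. x \<in> K \<Longrightarrow> cj G u x = x"
  shows "u \<in> M"
proof -
  obtain R :: nat where R: "R > 0" "\<And>x. x \<in> N \<Longrightarrow> x [^] R = \<one>"
    using torsion_normal_bounded[OF acc K r] by blast
  have cjN: "cj G g x \<in> N" if "g \<in> carrier G" "x \<in> N" for g x
    using normal_N that by (simp add: normal_iff_cj)
  note Nm = subgroup.m_closed[OF subgroup_N] and Ni = subgroup.m_inv_closed[OF subgroup_N]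
    and N1 = subgroup.one_closed[OF subgroup_N]
  have pow_fix: "cj G (g [^] k) x = x" if "g \<in> carrier G" "x \<in> carrier G" "cj G g x = x" for g x and k :: nat
    using that by (induction k) (simp_all add: cj_cj[symmetric])
  have upow: "u [^] k \<in> carrier G" for k :: nat using u by simp
  define C where "C i = {x \<in> N. cj G (u [^] (R ^ i)) x = x}" for i
  have C: "C i \<lhd> G" for i
    unfolding normal_iff_cj
  proof (intro conjI ballI subgroupI)
    fix g x assume "g \<in> carrier G" "x \<in> C i"
    then show "cj G g x \<in> C i"
      using upow N_in cjN by (auto simp: C_def cj_commute[of "u [^] (R ^ i)" g])
  qed (use N_in Nm Ni N1 upow in \<open>auto simp: C_def cj_mult cj_inv intro!: exI[of _ \<one>]\<close>)
  have "mono C"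
  proof (rule monoI)
    fix i j :: nat assume "i \<le> j"
    then obtain l where "j = i + l" by (auto simp: le_iff_add)
    then have "u [^] (R ^ j) = (u [^] (R ^ i)) [^] (R ^ l)" using u by (simp add: nat_pow_pow power_add)
    then show "C i \<subseteq> C j" using pow_fix[OF upow] N_in by (auto simp: C_def)
  qed
  then obtain n where n: "\<And>k. k \<ge> n \<Longrightarrow> C k = C n"
    by (rule acc_setsD[OF acc]) (use C N_subset in \<open>auto simp: C_def\<close>)
  define v where "v = u [^] (R ^ n)"
  have v: "v \<in> carrier G" using u by (simp add: v_def)
  have C_n: "C n = {x \<in> N. cj G v x = x}" by (simp add: C_def v_def)
  have "C (Suc n) = {x \<in> N. cj G (v [^] R) x = x}" using u by (simp add: C_def v_def nat_pow_pow mult.commute)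
  then have fix_pow: "cj G v x = x" if "x \<in> N" "cj G (v [^] R) x = x" for x
    using that n[of "Suc n"] C_n by auto
  have "K \<subseteq> C n" using pow_fix[OF u(1)] u(2) K N_in by (auto simp: C_n v_def)
  then have A: "C n \<noteq> {\<one>}" using K by (auto simp: normal_nontrivial C)
  let ?B = "comm_map G v ` N"
  have "C n \<inter> ?B \<subseteq> {\<one>}"
  proof
    fix y assume y: "y \<in> C n \<inter> ?B"
    then obtain x where x: "x \<in> N" "y = comm_map G v x" by blast
    have y': "y \<in> N" "cj G v y = y" using y by (auto simp: C_n)
    note cl = N_in[OF x(1)] N_in[OF y'(1)] v
    have vx: "cj G v x = y \<otimes> x" using cl by (simp add: x(2) comm_map_def m_assoc)
    have "cj G (v [^] k) x = y [^] k \<otimes> x" for k :: nat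
    proof (induction k)
      case (Suc k)
      have "cj G (v [^] Suc k) x = cj G (v [^] k) (y \<otimes> x)" using cl vx by (simp add: cj_cj[symmetric])
      also have "\<dots> = y \<otimes> (y [^] k \<otimes> x)" using cl Suc pow_fix[OF v _ y'(2)] by (simp add: cj_mult)
      also have "\<dots> = y [^] Suc k \<otimes> x" using cl nat_pow_Suc2[of y k] by (simp add: m_assoc[symmetric])
      finally show ?case .
    qed (use cl in simp)
    from this[of R] have "cj G (v [^] R) x = x" using R(2)[OF y'(1)] cl by simp
    then have "cj G v x = x" using fix_pow x by blast
    then show "y \<in> {\<one>}" using cl by (simp add: x(2) comm_map_def)
  qed
  moreover have B: "?B \<lhd> G" using normal_comm_map_image normal_N N_subset v .
  ultimately have "C n \<inter> ?B = {\<one>}"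
    using C subgroup.one_closed[of _ G] by (auto simp: normal_iff_cj)
  then have "?B = {\<one>}"
    using uniform[OF C B _ _ A] comm_map_in_normal[OF normal_N v] by (auto simp: C_n)
  then have "cj G v x = x" if "x \<in> N" for x
    using comm_map_eq_one[OF v] N_in that by blast
  then have "v \<in> M" using centralizer v by blast
  then show "u \<in> M" using root_closed[OF u(1), of "R ^ n"] R(1) by (simp add: v_def)
qed

lemma faithful_actionD:
  assumes act: "faithful_action G E \<phi>" and g: "g \<in> carrier G" "\<And>x. x \<in> E \<Longrightarrow> \<phi> g x = x"
  shows "g = \<one>"
proof -
  interpret faithful_action G E \<phi> by fact
  have "\<phi> g = \<phi> \<one>"
  proof (rule extensionalityI)
    show "\<phi> g \<in> extensional E" "\<phi> \<one> \<in> extensional E"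
      using bij_prop0[OF g(1)] bij_prop0[OF one_closed] by (auto simp: Bij_def)
    show "\<phi> g x = \<phi> \<one> x" if "x \<in> E" for x using g(2) that id_eq_one[symmetric] by simp
  qed
  then show ?thesis using faithful g by (auto simp: inj_on_def)
qed

lemma cj_stabilizer_iff:
  assumes act: "group_action G E \<phi>" and g: "g \<in> carrier G" "h \<in> carrier G" "x \<in> E"
  shows "cj G g h \<in> stabilizer G \<phi> x \<longleftrightarrow> \<phi> h (\<phi> (inv g) x) = \<phi> (inv g) x"
proof -
  interpret group_action G E \<phi> by fact
  let ?y = "\<phi> (inv g) x"
  have y: "?y \<in> E" using element_image[OF _ g(3) refl] g by simp
  have hy: "\<phi> h ?y \<in> E" using element_image[OF g(2) y refl] .
  have "\<phi> (cj G g h) x = \<phi> g (\<phi> h ?y)"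
    using g y by (simp add: cj_def composition_rule m_assoc)
  moreover have "\<phi> g ?y = x"
    using g composition_rule[OF g(3) g(1), of "inv g"] id_eq_one[symmetric] by simp
  ultimately show ?thesis
    using inj_on_eq_iff[OF inj_prop[OF g(1)] hy y] cj_closed[OF g(1,2)] by (simp add: stabilizer_def)
qed

lemma ex_normal_in_stabilizers:
  assumes F: "finite F" "F \<subseteq> carrier G - M" and nontriv: "N \<noteq> {\<one>}"
  obtains r :: nat and K where "r > 0" "K \<lhd> G" "K \<subseteq> N" "K \<noteq> {\<one>}"
    "\<And>H. subgroup H G \<Longrightarrow> (\<And>n. n \<in> N \<Longrightarrow> \<exists>h\<in>F. cj G n h \<in> H) \<Longrightarrow>
      \<exists>h\<in>F. \<forall>x\<in>K. x [^] r \<in> H \<and> comm_map G (h [^] r) x \<in> H"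
proof -
  have FG: "F \<subseteq> carrier G" using F by blast
  obtain r :: nat where r: "r > 0"
    "\<And>H. subgroup H G \<Longrightarrow> (\<And>n. n \<in> N \<Longrightarrow> \<exists>h\<in>F. cj G n h \<in> H) \<Longrightarrow>
      \<exists>h\<in>F. (\<forall>x \<in> comm_map G h ` N. x [^] r \<in> H \<and> comm_map G (h [^] r) x \<in> H)"
    by (rule finite_conjugates_bound[OF normal_N N_subset F(1) FG]) blast
  let ?K = "N \<inter> (\<Inter>h\<in>F. comm_map G h ` N)"
  have "comm_map G h ` N \<lhd> G \<and> comm_map G h ` N \<subseteq> N \<and> comm_map G h ` N \<noteq> {\<one>}" if h: "h \<in> F" for h
  proof (intro conjI)
    have hG: "h \<in> carrier G" "h \<notin> M" using h F by auto
    show "comm_map G h ` N \<lhd> G" using normal_comm_map_image normal_N N_subset hG(1) .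
    show "comm_map G h ` N \<subseteq> N" using comm_map_in_normal[OF normal_N hG(1)] by blast
    show "comm_map G h ` N \<noteq> {\<one>}"
    proof
      assume "comm_map G h ` N = {\<one>}"
      then have "cj G h x = x" if "x \<in> N" for x
        using comm_map_eq_one[OF hG(1)] N_in that by blast
      then show False using centralizer hG by blast
    qed
  qed
  then have K: "?K \<lhd> G" "?K \<noteq> {\<one>}" using finite_Inter_nontrivial[OF F(1) nontriv] by auto
  show thesis
  proof (rule that[OF r(1) K(1) _ K(2)])
    fix H assume "subgroup H G" "\<And>n. n \<in> N \<Longrightarrow> \<exists>h\<in>F. cj G n h \<in> H"
    then obtain h where "h \<in> F" "\<forall>x \<in> comm_map G h ` N. x [^] r \<in> H \<and> comm_map G (h [^] r) x \<in> H"
      using r(2) by blast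
    then show "\<exists>h\<in>F. \<forall>x\<in>?K. x [^] r \<in> H \<and> comm_map G (h [^] r) x \<in> H" by blast
  qed blast
qed

lemma ex_point_moved:
  assumes acc: "acc_sets {U. U \<lhd> G \<and> U \<subseteq> M}"
    and act: "faithful_action G E \<phi>" and "E \<noteq> {}"
    and F: "finite F" "F \<subseteq> carrier G - M"
  shows "\<exists>x\<in>E. \<forall>h\<in>F. \<phi> h x \<noteq> x"
proof (rule ccontr)
  assume "\<not> ?thesis"
  then have fixed: "\<And>x. x \<in> E \<Longrightarrow> \<exists>h\<in>F. \<phi> h x = x" by blast
  interpret act: faithful_action G E \<phi> by fact
  have FG: "h \<in> carrier G" "h \<notin> M" if "h \<in> F" for h using F that by auto
  obtain h0 where h0: "h0 \<in> F" using fixed \<open>E \<noteq> {}\<close> by blast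
  have nontriv: "N \<noteq> {\<one>}" using centralizer[of h0] FG[OF h0] by auto
  obtain r :: nat and K where r: "r > 0" and K: "K \<lhd> G" "K \<subseteq> N" "K \<noteq> {\<one>}"
    and K_H: "\<And>H. subgroup H G \<Longrightarrow> (\<And>n. n \<in> N \<Longrightarrow> \<exists>h\<in>F. cj G n h \<in> H) \<Longrightarrow>
      \<exists>h\<in>F. \<forall>x\<in>K. x [^] r \<in> H \<and> comm_map G (h [^] r) x \<in> H"
    using ex_normal_in_stabilizers[OF F nontriv] by blast
  have KN: "x \<in> N" if "x \<in> K" for x using K that by blast
  have stab: "\<exists>h\<in>F. \<forall>y\<in>K. y [^] r \<in> stabilizer G \<phi> x \<and> comm_map G (h [^] r) y \<in> stabilizer G \<phi> x"
    if x: "x \<in> E" for x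
  proof (rule K_H)
    show "subgroup (stabilizer G \<phi> x) G" using act.stabilizer_subgroup[OF x] .
    fix n assume n: "n \<in> N"
    then have nG: "n \<in> carrier G" using N_in by blast
    have "\<phi> (inv n) x \<in> E" using act.element_image[OF inv_closed[OF nG] x refl] .
    then obtain h where "h \<in> F" "\<phi> h (\<phi> (inv n) x) = \<phi> (inv n) x" using fixed by blast
    then show "\<exists>h\<in>F. cj G n h \<in> stabilizer G \<phi> x"
      using cj_stabilizer_iff[OF act.group_action_axioms nG _ x] FG by blast
  qed
  have "y [^] r = \<one>" if "y \<in> K" for y
    using stab that KN N_in by (intro faithful_actionD[OF act]) (auto simp: stabilizer_def)
  note central = centralizer_torsion_normal[OF acc K r this]
  let ?D = "N \<inter> (\<Inter>h\<in>F. comm_map G (h [^] r) ` K)"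
  have KM: "K \<subseteq> M" using K(2) N_subset by blast
  have "comm_map G (h [^] r) ` K \<lhd> G \<and> comm_map G (h [^] r) ` K \<subseteq> N \<and> comm_map G (h [^] r) ` K \<noteq> {\<one>}"
    if h: "h \<in> F" for h
  proof (intro conjI)
    have hr: "h [^] r \<in> carrier G" "h [^] r \<notin> M" using root_closed[of h r] FG[OF h] r by auto
    show "comm_map G (h [^] r) ` K \<lhd> G" using normal_comm_map_image K(1) KM hr(1) .
    show "comm_map G (h [^] r) ` K \<subseteq> N" using comm_map_in_normal[OF K(1) hr(1)] K(2) by blast
    show "comm_map G (h [^] r) ` K \<noteq> {\<one>}"
    proof
      assume "comm_map G (h [^] r) ` K = {\<one>}"
      then have "cj G (h [^] r) x = x" if "x \<in> K" for x
        using comm_map_eq_one[OF hr(1)] KN N_in that by blast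
      then show False using central hr by blast
    qed
  qed
  then have D: "?D \<lhd> G" "?D \<noteq> {\<one>}" using finite_Inter_nontrivial[OF F(1) nontriv] by auto
  then obtain y where y: "y \<in> ?D" "y \<noteq> \<one>" using normal_nontrivial by blast
  have "y = \<one>"
  proof (rule faithful_actionD[OF act])
    show "y \<in> carrier G" using y N_in by blast
    fix x assume x: "x \<in> E"
    obtain h where h: "h \<in> F" "\<forall>y\<in>K. comm_map G (h [^] r) y \<in> stabilizer G \<phi> x" using stab[OF x] by blast
    then show "\<phi> y x = x" using y by (auto simp: stabilizer_def)
  qed
  then show False using y by blast
qed

lemma ex_point_moved_torsion_free:
  assumes act: "faithful_action G E \<phi>" and "E \<noteq> {}"
    and F: "finite F" "F \<subseteq> carrier G - M"
    and z: "z \<in> N" "z \<noteq> \<one>"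
    and torsion_free: "\<And>x n. x \<in> N \<Longrightarrow> n > (0 :: nat) \<Longrightarrow> x [^] n = \<one> \<Longrightarrow> x = \<one>"
  shows "\<exists>x\<in>E. (\<forall>h\<in>F. \<phi> h x \<noteq> x) \<and> \<phi> z x \<noteq> x"
proof (rule ccontr)
  assume "\<not> ?thesis"
  then have fixed: "\<And>x. x \<in> E \<Longrightarrow> \<phi> z x \<noteq> x \<Longrightarrow> \<exists>h\<in>F. \<phi> h x = x" by blast
  interpret act: faithful_action G E \<phi> by fact
  note cj_stab = cj_stabilizer_iff[OF act.group_action_axioms]
  have FG: "h \<in> carrier G" "h \<notin> M" if "h \<in> F" for h using F that by auto
  have zG: "z \<in> carrier G" using z N_in by blast
  obtain r :: nat and K where r: "r > 0" and K: "K \<lhd> G" "K \<subseteq> N" "K \<noteq> {\<one>}"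
    and K_H: "\<And>H. subgroup H G \<Longrightarrow> (\<And>n. n \<in> N \<Longrightarrow> \<exists>h\<in>F. cj G n h \<in> H) \<Longrightarrow>
      \<exists>h\<in>F. \<forall>x\<in>K. x [^] r \<in> H \<and> comm_map G (h [^] r) x \<in> H"
    using ex_normal_in_stabilizers[OF F] z by blast
  let ?P = "(\<lambda>x. x [^] r) ` K"
  let ?Z = "generate G ((\<lambda>g. cj G g z) ` carrier G)"
  have P: "?P \<lhd> G" "?P \<subseteq> N"
    using normal_pow_image[OF K(1)] K(2) N_subset subgroup_nat_pow_closed[OF subgroup_N] by auto
  have "?P \<noteq> {\<one>}" using torsion_free r K by (auto simp: normal_nontrivial P(1) normal_nontrivial[OF K(1)])
  have Z: "?Z \<lhd> G"
  proof (rule normal_generateI)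
    fix h g assume "h \<in> (\<lambda>g. cj G g z) ` carrier G" "g \<in> carrier G"
    then show "g \<otimes> h \<otimes> inv g \<in> (\<lambda>g. cj G g z) ` carrier G"
      using zG by (auto simp: cj_def[of G g, symmetric] cj_cj)
  qed (use zG in auto)
  have ZN: "?Z \<subseteq> N"
    using normal_N z by (intro generate_subgroup_incl[OF _ subgroup_N]) (auto simp: normal_iff_cj)
  have "cj G \<one> z \<in> ?Z" by (intro generate.incl imageI one_closed)
  then have "z \<in> ?Z" using zG by simp
  then have "?Z \<noteq> {\<one>}" using z by blast
  then have "?P \<inter> ?Z \<noteq> {\<one>}" using uniform[OF P(1) Z P(2) ZN \<open>?P \<noteq> {\<one>}\<close>] by blast
  then obtain y where y: "y \<in> ?P" "y \<in> ?Z" "y \<noteq> \<one>" using normal_nontrivial[OF normal_Int[OF P(1) Z]] by blast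
  have "y = \<one>"
  proof (rule faithful_actionD[OF act])
    show yG: "y \<in> carrier G" using y ZN N_in by blast
    fix x assume x: "x \<in> E"
    show "\<phi> y x = x"
    proof (cases "\<exists>g\<in>carrier G. cj G g z \<notin> stabilizer G \<phi> x")
      case False
      then have "?Z \<subseteq> stabilizer G \<phi> x"
        by (intro generate_subgroup_incl[OF _ act.stabilizer_subgroup[OF x]]) auto
      then show ?thesis using y by (auto simp: stabilizer_def)
    next
      case True
      then obtain g where g: "g \<in> carrier G" "cj G g z \<notin> stabilizer G \<phi> x" by blast
      let ?x = "\<phi> (inv g) x"
      have x': "?x \<in> E" using act.element_image[OF inv_closed[OF g(1)] x refl] .
      have moved: "\<phi> z ?x \<noteq> ?x" using cj_stab[OF g(1) zG x] g by blast
      have "\<exists>h\<in>F. \<forall>y\<in>K. y [^] r \<in> stabilizer G \<phi> ?x \<and> comm_map G (h [^] r) y \<in> stabilizer G \<phi> ?x"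
      proof (rule K_H)
        show "subgroup (stabilizer G \<phi> ?x) G" using act.stabilizer_subgroup[OF x'] .
        fix n assume n: "n \<in> N"
        then have nG: "n \<in> carrier G" using N_in by blast
        have E: "\<phi> (inv n) ?x \<in> E" using act.element_image[OF inv_closed[OF nG] x' refl] .
        have "cj G n z = z" using cj_M_trivial n z N_in by blast
        then have "\<phi> z (\<phi> (inv n) ?x) \<noteq> \<phi> (inv n) ?x"
          using cj_stab[OF nG zG x'] moved by (auto simp: stabilizer_def)
        then obtain h where "h \<in> F" "\<phi> h (\<phi> (inv n) ?x) = \<phi> (inv n) ?x" using fixed[OF E] by blast
        then show "\<exists>h\<in>F. cj G n h \<in> stabilizer G \<phi> ?x" using cj_stab[OF nG _ x'] FG by blast
      qed
      then have stab: "?P \<subseteq> stabilizer G \<phi> ?x" by blast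
      have "cj G (inv g) y \<in> ?P" using P(1) y(1) g(1) inv_closed unfolding normal_iff_cj by blast
      then have "\<phi> (cj G (inv g) y) ?x = ?x" using stab by (auto simp: stabilizer_def)
      then have "cj G g (cj G (inv g) y) \<in> stabilizer G \<phi> x"
        using cj_stab[OF g(1) _ x, of "cj G (inv g) y"] yG g by simp
      then show ?thesis using yG g by (simp add: stabilizer_def)
    qed
  qed
  then show False using y by blast
qed

end

section \<open>Non-foldable lifts\<close>

lemma (in comm_group) finprod_subgroup_closed:
  assumes "subgroup U G" "finite F" "\<And>i. i \<in> F \<Longrightarrow> f i \<in> U"
  shows "finprod G f F \<in> U"
  using assms(2,3)
proof (induction F rule: finite_induct)
  case empty
  then show ?case using subgroup.one_closed[OF assms(1)] by simp
next
  case (insert i F)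
  then show ?case
    using subgroup.mem_carrier[OF assms(1)] subgroup.m_closed[OF assms(1)]
    by (subst finprod_insert) auto
qed

lemma (in group) subgroup_relative_iff:
  assumes V: "monoid.mult V = monoid.mult G" "one V = \<one>" and C: "subgroup (carrier V) G"
  shows "subgroup U V \<longleftrightarrow> subgroup U G \<and> U \<subseteq> carrier V"
proof -
  have inv: "inv\<^bsub>V\<^esub> x = inv x" if "x \<in> carrier V" for x
    unfolding m_inv_def[of V] V
    using that subgroup.mem_carrier[OF C] subgroup.m_inv_closed[OF C]
    by (intro the_equality) (auto intro: inv_equality[symmetric])
  show ?thesis
    using subgroup.mem_carrier[OF C] inv
    unfolding subgroup_def V by (auto simp: subset_iff)
qed

lemma free_abelian_comm_group:
  assumes "free_abelian Q"
  shows "comm_group Q"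
    and "\<And>x n. x \<in> carrier Q \<Longrightarrow> n > (0 :: nat) \<Longrightarrow> x [^]\<^bsub>Q\<^esub> n = \<one>\<^bsub>Q\<^esub> \<Longrightarrow> x = \<one>\<^bsub>Q\<^esub>"
proof -
  obtain S :: "'a set" where Q: "group Q" and "Q \<cong> free_Abelian_group S"
    using assms by (auto simp: free_abelian_def)
  then obtain f where f: "f \<in> iso Q (free_Abelian_group S)" by (auto simp: is_iso_def)
  interpret Q: group Q by fact
  have hom: "f \<in> hom Q (free_Abelian_group S)" and inj: "inj_on f (carrier Q)"
    using f by (auto simp: iso_def bij_betw_def)
  have mult: "f (x \<otimes>\<^bsub>Q\<^esub> y) = f x + f y" if "x \<in> carrier Q" "y \<in> carrier Q" for x y
    using hom_mult[OF hom that] by simp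
  show "comm_group Q"
  proof (rule Q.group_comm_groupI)
    fix x y assume "x \<in> carrier Q" "y \<in> carrier Q"
    then show "x \<otimes>\<^bsub>Q\<^esub> y = y \<otimes>\<^bsub>Q\<^esub> x"
      using mult by (intro inj_onD[OF inj]) (auto simp: add.commute)
  qed
  fix x and n :: nat assume x: "x \<in> carrier Q" "n > 0" "x [^]\<^bsub>Q\<^esub> n = \<one>\<^bsub>Q\<^esub>"
  have one: "f \<one>\<^bsub>Q\<^esub> = 0" using mult[of "\<one>\<^bsub>Q\<^esub>" "\<one>\<^bsub>Q\<^esub>"] by simp
  have "frag_cmul (int n) (f x) = f (x [^]\<^bsub>Q\<^esub> n)"
    using hom_nat_pow[OF hom x(1) Q group_free_Abelian_group] by simp
  then have "f x = 0" using x(2,3) one by simp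
  then show "x = \<one>\<^bsub>Q\<^esub>" using one x(1) by (intro inj_onD[OF inj]) auto
qed

lemma (in faithful_action) inj_on_iff_moved:
  assumes x: "x \<in> E" and F: "F \<subseteq> carrier G"
  shows "inj_on (\<lambda>g. \<phi> g x) F \<longleftrightarrow> (\<forall>g\<in>F. \<forall>h\<in>F. g \<noteq> h \<longrightarrow> \<phi> (inv g \<otimes> h) x \<noteq> x)"
proof -
  interpret group G using group_hom group_hom.axioms(1) by auto
  have "\<phi> (inv g \<otimes> h) x = x \<longleftrightarrow> \<phi> g x = \<phi> h x" if "g \<in> F" "h \<in> F" for g h
  proof -
    have gh: "g \<in> carrier G" "h \<in> carrier G" using that F by auto
    have hx: "\<phi> h x \<in> E" "\<phi> g x \<in> E" using element_image[OF _ x refl] gh by auto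
    have "\<phi> g (\<phi> (inv g \<otimes> h) x) = \<phi> h x"
      using composition_rule[OF x gh(1), of "inv g \<otimes> h"] gh by (simp add: m_assoc[symmetric])
    then show ?thesis
      using inj_on_eq_iff[OF inj_prop[OF gh(1)] _ x, of "\<phi> (inv g \<otimes> h) x"]
        element_image[OF _ x refl, of "inv g \<otimes> h"] gh by auto
  qed
  then show ?thesis by (auto simp: inj_on_def)
qed

lemma uniform_extension_kernel:
  fixes G :: "('g, 'b) monoid_scheme" and Q :: "('q, 'c) monoid_scheme"
  assumes "group G" and Q: "free_abelian Q"
    and p: "p \<in> epi G Q" and M: "M = kernel G Q p" and comm: "comm_group (G\<lparr>carrier := M\<rparr>)"
    and N: "submodule N (group_ring Q) (kernel_module G p M)"
    and uniform: "uniform_module (group_ring Q) ((kernel_module G p M)\<lparr>carrier := N\<rparr>)"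
    and centralizer: "module_centralizer Q ((kernel_module G p M)\<lparr>carrier := N\<rparr>) = {\<one>\<^bsub>Q\<^esub>}"
  shows "uniform_extension G M N"
proof -
  interpret G: group G by fact
  interpret Q: comm_group Q using free_abelian_comm_group(1)[OF Q] .
  have hom: "p \<in> hom G Q" and surj: "p ` carrier G = carrier Q"
    using p by (auto simp: epi_def)
  interpret p: group_hom G Q p using hom by unfold_locales
  interpret A: comm_group "G\<lparr>carrier := M\<rparr>" by fact
  let ?KM = "kernel_module G p M"
  note R = group_ring_simps
  have sM: "subgroup M G" unfolding M using p.subgroup_kernel .
  note MG = subgroup.mem_carrier[OF sM]
  have M_iff: "x \<in> M \<longleftrightarrow> x \<in> carrier G \<and> p x = \<one>\<^bsub>Q\<^esub>" for x by (auto simp: M kernel_def)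
  have KM: "carrier ?KM = M" "add ?KM = (\<otimes>\<^bsub>G\<^esub>)" "ring.zero ?KM = \<one>\<^bsub>G\<^esub>"
    "smult ?KM r x = (\<Otimes>\<^bsub>G\<lparr>carrier := M\<rparr>\<^esub>q \<in> Poly_Mapping.keys r.
      conj_action G p q x [^]\<^bsub>G\<lparr>carrier := M\<rparr>\<^esub> Poly_Mapping.lookup r q)" for r x
    by (simp_all add: kernel_module_def action_module_simps)
  have act: "conj_action G p (p g) x = cj G g x" if "g \<in> carrier G" "x \<in> M" for g x
    using conj_action_eq[OF G.is_group Q.is_group hom, of g x] comm that by (simp add: M cj_def)
  have cjM: "cj G g x \<in> M" if "g \<in> carrier G" "x \<in> M" for g x
    using that by (auto simp: M_iff cj_def)
  have smult_of: "smult ?KM (frag_of (p g)) x = cj G g x" if "g \<in> carrier G" "x \<in> M" for g x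
    using that cjM[OF that] MG[OF cjM[OF that]] by (simp add: KM act)
  have sub: "subgroup U (add_monoid ?KM) \<longleftrightarrow> subgroup U G \<and> U \<subseteq> M" for U
    using G.subgroup_relative_iff[of "add_monoid ?KM" U] sM by (simp add: KM)
  have sN: "subgroup N G" and NM: "N \<subseteq> M"
    using submodule.axioms(1)[OF N] sub by auto
  have cjN: "cj G g x \<in> N" if "g \<in> carrier G" "x \<in> N" for g x
    using submodule.smult_closed[OF N, of "frag_of (p g)" x] that NM smult_of[of g x] by (auto simp: R)
  have normal_sub: "submodule U (group_ring Q) (?KM\<lparr>carrier := N\<rparr>)" if "U \<lhd> G" "U \<subseteq> N" for U
  proof -
    have sU: "subgroup U G" and cjU: "\<And>g x. g \<in> carrier G \<Longrightarrow> x \<in> U \<Longrightarrow> cj G g x \<in> U"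
      using that by (auto simp: G.normal_iff_cj)
    have UM: "U \<subseteq> M" using that NM by blast
    have sUA: "subgroup U (G\<lparr>carrier := M\<rparr>)" using G.subgroup_incl[OF sU sM UM] .
    have "subgroup U (add_monoid (?KM\<lparr>carrier := N\<rparr>))"
      using G.subgroup_relative_iff[of "add_monoid (?KM\<lparr>carrier := N\<rparr>)" U] sN sU that by (simp add: KM)
    moreover have "smult ?KM r x \<in> U" if r: "Poly_Mapping.keys r \<subseteq> carrier Q" and x: "x \<in> U" for r x
      unfolding KM
    proof (rule A.finprod_subgroup_closed[OF sUA])
      fix q assume "q \<in> Poly_Mapping.keys r"
      then obtain g where g: "g \<in> carrier G" "q = p g" using r surj by blast
      then have "conj_action G p q x \<in> U" using act cjU x UM by auto
      then show "conj_action G p q x [^]\<^bsub>G\<lparr>carrier := M\<rparr>\<^esub> Poly_Mapping.lookup r q \<in> U"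
        by (rule A.subgroup_int_pow_closed[OF sUA])
    qed simp
    ultimately show ?thesis
      by (intro submodule.intro submodule_axioms.intro) (auto simp: R)
  qed
  have Mker: "M \<lhd> G" using sM cjM by (auto simp: G.normal_iff_cj)
  show ?thesis
  proof (intro uniform_extension.intro abelian_normal.intro abelian_normal_axioms.intro
      uniform_extension_axioms.intro)
    show "group G" "M \<lhd> G" "comm_group (G\<lparr>carrier := M\<rparr>)" "N \<subseteq> M" by fact+
    show "N \<lhd> G" using sN cjN by (auto simp: G.normal_iff_cj)
  next
    fix g h assume "g \<in> carrier G" "h \<in> carrier G"
    then show "comm_map G g h \<in> M"
      using Q.m_lcomm[of "p h" "inv\<^bsub>Q\<^esub> p g" "inv\<^bsub>Q\<^esub> p h"]
      by (simp add: M_iff comm_map_def cj_def Q.m_assoc)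
  next
    fix B C assume "B \<lhd> G" "C \<lhd> G" "B \<subseteq> N" "C \<subseteq> N" "B \<noteq> {\<one>\<^bsub>G\<^esub>}" "C \<noteq> {\<one>\<^bsub>G\<^esub>}"
    then show "B \<inter> C \<noteq> {\<one>\<^bsub>G\<^esub>}"
      using uniform normal_sub by (simp add: uniform_module_def KM)
  next
    fix g assume g: "g \<in> carrier G" "\<And>x. x \<in> N \<Longrightarrow> cj G g x = x"
    then have "p g \<in> module_centralizer Q (?KM\<lparr>carrier := N\<rparr>)"
      using NM smult_of by (auto simp: module_centralizer_def subset_iff)
    then show "g \<in> M" using centralizer g by (simp add: M_iff)
  next
    fix g and n :: nat assume g: "g \<in> carrier G" "0 < n" "g [^]\<^bsub>G\<^esub> n \<in> M"
    then have "p g [^]\<^bsub>Q\<^esub> n = \<one>\<^bsub>Q\<^esub>" using p.hom_nat_pow[of g n] by (simp add: M_iff)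
    then show "g \<in> M" using free_abelian_comm_group(2)[OF Q, of "p g" n] g by (simp add: M_iff)
  qed
qed

theorem theorem6p10:
  fixes G :: "('g, 'b) monoid_scheme" and Q :: "('q, 'c) monoid_scheme"
    and p :: "'g \<Rightarrow> 'q" and M N L :: "'g set"
  assumes "group G" and "finitely_generated G" and "metabelian G"
    and "free_abelian Q"
    and "p \<in> epi G Q" and "M = kernel G Q p" and "comm_group (G\<lparr>carrier := M\<rparr>)"
    and "submodule N (group_ring Q) (kernel_module G p M)"
    and "uniform_module (group_ring Q) ((kernel_module G p M)\<lparr>carrier := N\<rparr>)"
    and "module_centralizer Q ((kernel_module G p M)\<lparr>carrier := N\<rparr>) = {\<one>\<^bsub>Q\<^esub>}"
    and "lift G Q p L"
  shows "nonfoldable TYPE('x) G L \<and>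
    (torsion_free (G\<lparr>carrier := N\<rparr>) \<longrightarrow>
      (\<forall>m \<in> N. m \<noteq> \<one>\<^bsub>G\<^esub> \<longrightarrow> nonfoldable TYPE('x) G (L <#>\<^bsub>G\<^esub> generate G {m})))"
proof -
  interpret uniform_extension G M N
    using uniform_extension_kernel assms by blast
  interpret Q: group Q using assms(4) by (simp add: free_abelian_def)
  interpret p: group_hom G Q p using assms(5) by unfold_locales (auto simp: epi_def)
  have M_iff: "x \<in> M \<longleftrightarrow> x \<in> carrier G \<and> p x = \<one>\<^bsub>Q\<^esub>" for x by (auto simp: assms(6) kernel_def)
  have L: "L \<subseteq> carrier G" using assms(11) by (simp add: lift_def)
  have L_eq: "g = h" if "g \<in> L" "h \<in> L" "inv\<^bsub>G\<^esub> g \<otimes>\<^bsub>G\<^esub> h \<in> M" for g h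
  proof -
    have G: "g \<in> carrier G" "h \<in> carrier G" using that L by auto
    then have "inv\<^bsub>Q\<^esub> p g \<otimes>\<^bsub>Q\<^esub> p h = \<one>\<^bsub>Q\<^esub>" using that(3) by (simp add: M_iff)
    then have "p g = p h" using G Q.inv_solve_left' by fastforce
    then show ?thesis using assms(11) that G p.hom_closed unfolding lift_def by metis
  qed
  obtain S where S: "finite S" "S \<subseteq> carrier G" "generate G S = carrier G"
    using assms(2) by (auto simp: finitely_generated_def)
  note acc = acc_normal_subgroups[OF S]
  have diffs: "finite ((\<lambda>(g, h). inv\<^bsub>G\<^esub> g \<otimes>\<^bsub>G\<^esub> h) ` (F \<times> F))" if "finite F" for F
    using that by simp
  have "nonfoldable TYPE('x) G L"
    unfolding nonfoldable_def
  proof (intro conjI allI impI L)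
    fix E :: "'x set" and \<phi> F
    assume *: "E \<noteq> {} \<and> faithful_action G E \<phi> \<and> finite F \<and> F \<subseteq> L"
    let ?D = "(\<lambda>(g, h). inv\<^bsub>G\<^esub> g \<otimes>\<^bsub>G\<^esub> h) ` (F \<times> F) - M"
    have "\<exists>x\<in>E. \<forall>h\<in>?D. \<phi> h x \<noteq> x"
      by (rule ex_point_moved[OF acc]) (use * L diffs in auto)
    then obtain x where x: "x \<in> E" "\<forall>h\<in>?D. \<phi> h x \<noteq> x" by blast
    have "inj_on (\<lambda>g. \<phi> g x) F"
    proof (subst faithful_action.inj_on_iff_moved[of G E])
      show "\<forall>g\<in>F. \<forall>h\<in>F. g \<noteq> h \<longrightarrow> \<phi> (inv\<^bsub>G\<^esub> g \<otimes>\<^bsub>G\<^esub> h) x \<noteq> x"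
        using x(2) L_eq * by fast
    qed (use * L x in auto)
    with x show "\<exists>x\<in>E. inj_on (\<lambda>g. \<phi> g x) F" by blast
  qed
  moreover have "nonfoldable TYPE('x) G (L <#>\<^bsub>G\<^esub> generate G {m})"
    if tf: "torsion_free (G\<lparr>carrier := N\<rparr>)" and m: "m \<in> N" "m \<noteq> \<one>\<^bsub>G\<^esub>" for m
  proof -
    have mG: "m \<in> carrier G" "m \<in> M" using m N_in by auto
    have torsion_free: "x = \<one>\<^bsub>G\<^esub>" if "x \<in> N" "n > 0" "x [^]\<^bsub>G\<^esub> n = \<one>\<^bsub>G\<^esub>" for x and n :: nat
      using tf that unfolding torsion_free_def nat_pow_consistent[symmetric] by auto
    let ?L = "L <#>\<^bsub>G\<^esub> generate G {m}"
    note gen = generate_pow[OF mG(1)]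
    have LG: "?L \<subseteq> carrier G" using L generate_incl[of "{m}"] mG by (intro set_mult_closed) auto
    have in_gen: "inv\<^bsub>G\<^esub> g \<otimes>\<^bsub>G\<^esub> h \<in> generate G {m}"
      if gh: "g \<in> ?L" "h \<in> ?L" "inv\<^bsub>G\<^esub> g \<otimes>\<^bsub>G\<^esub> h \<in> M" for g h
    proof -
      have sgen: "subgroup (generate G {m}) G" using generate_is_subgroup mG by simp
      have genM: "x \<in> M" if "x \<in> generate G {m}" for x
        using generate_subgroup_incl[OF _ subgroup_M, of "{m}"] mG that by blast
      obtain a x b y where ab: "a \<in> L" "x \<in> generate G {m}" "g = a \<otimes>\<^bsub>G\<^esub> x"
        "b \<in> L" "y \<in> generate G {m}" "h = b \<otimes>\<^bsub>G\<^esub> y"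
        using gh by (auto simp: set_mult_def)
      have abG: "a \<in> carrier G" "b \<in> carrier G" "x \<in> carrier G" "y \<in> carrier G"
        using ab L genM M_carrier by auto
      have "p x = \<one>\<^bsub>Q\<^esub>" "p y = \<one>\<^bsub>Q\<^esub>" using genM ab M_iff by auto
      then have "inv\<^bsub>G\<^esub> a \<otimes>\<^bsub>G\<^esub> b \<in> M"
        using gh(3) ab(3,6) abG by (simp add: M_iff)
      then have "a = b" using L_eq ab by blast
      then have "inv\<^bsub>G\<^esub> g \<otimes>\<^bsub>G\<^esub> h = inv\<^bsub>G\<^esub> x \<otimes>\<^bsub>G\<^esub> y"
        using ab(3,6) abG by (simp add: inv_mult_group m_assoc)
      then show ?thesis using ab subgroup.m_closed[OF sgen] subgroup.m_inv_closed[OF sgen] by simp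
    qed
    show ?thesis
      unfolding nonfoldable_def
    proof (intro conjI allI impI LG)
      fix E :: "'x set" and \<phi> F
      assume *: "E \<noteq> {} \<and> faithful_action G E \<phi> \<and> finite F \<and> F \<subseteq> ?L"
      interpret act: faithful_action G E \<phi> using * by blast
      let ?D = "(\<lambda>(g, h). inv\<^bsub>G\<^esub> g \<otimes>\<^bsub>G\<^esub> h) ` (F \<times> F)"
      define I where "I = {d \<in> ?D. d \<in> M \<and> d \<noteq> \<one>\<^bsub>G\<^esub>}"
      have "finite I" using diffs * by (simp add: I_def)
      have "\<exists>k :: int. d = m [^]\<^bsub>G\<^esub> k" if d: "d \<in> I" for d
      proof -
        obtain g h where "g \<in> F" "h \<in> F" "d = inv\<^bsub>G\<^esub> g \<otimes>\<^bsub>G\<^esub> h" "d \<in> M"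
          using d by (auto simp: I_def)
        then have "d \<in> generate G {m}" using in_gen[of g h] * by blast
        then show ?thesis unfolding gen by blast
      qed
      then obtain k :: "'g \<Rightarrow> int" where k: "\<And>d. d \<in> I \<Longrightarrow> d = m [^]\<^bsub>G\<^esub> k d" by metis
      have k0: "k d \<noteq> 0" if "d \<in> I" for d using k[OF that] that by (auto simp: I_def)
      define e where "e = nat \<bar>\<Prod>d\<in>I. k d\<bar>"
      have e: "e > 0" using k0 \<open>finite I\<close> by (simp add: e_def)
      define z where "z = m [^]\<^bsub>G\<^esub> e"
      have z: "z \<in> N" "z \<noteq> \<one>\<^bsub>G\<^esub>"
        using subgroup_nat_pow_closed[OF subgroup_N m(1)] torsion_free[OF m(1) e] m(2) by (auto simp: z_def)
      have "\<exists>x\<in>E. (\<forall>h\<in>?D - M. \<phi> h x \<noteq> x) \<and> \<phi> z x \<noteq> x"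
        by (rule ex_point_moved_torsion_free[OF _ _ _ _ z torsion_free]) (use * LG diffs in auto)
      then obtain x where x: "x \<in> E" "\<And>h. h \<in> ?D - M \<Longrightarrow> \<phi> h x \<noteq> x" "\<phi> z x \<noteq> x" by blast
      have moved: "\<phi> d x \<noteq> x" if d: "d \<in> I" for d
      proof
        assume "\<phi> d x = x"
        have stab: "subgroup (stabilizer G \<phi> x) G" using act.stabilizer_subgroup[OF x(1)] .
        have dG: "d \<in> carrier G" using d M_carrier by (auto simp: I_def)
        have "k d dvd int e" using d \<open>finite I\<close> by (simp add: e_def dvd_prodI)
        then obtain l where l: "int e = k d * l" by blast
        have "z = m [^]\<^bsub>G\<^esub> int e" by (simp add: z_def int_pow_int)
        also have "\<dots> = d [^]\<^bsub>G\<^esub> l" unfolding l by (subst (2) k[OF d]) (simp add: mG int_pow_pow)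
        also have "\<dots> \<in> stabilizer G \<phi> x"
          using \<open>\<phi> d x = x\<close> dG by (intro subgroup_int_pow_closed[OF stab]) (simp add: stabilizer_def)
        finally show False using x(3) by (simp add: stabilizer_def)
      qed
      have "inj_on (\<lambda>g. \<phi> g x) F"
      proof (subst act.inj_on_iff_moved)
        show "\<forall>g\<in>F. \<forall>h\<in>F. g \<noteq> h \<longrightarrow> \<phi> (inv\<^bsub>G\<^esub> g \<otimes>\<^bsub>G\<^esub> h) x \<noteq> x"
        proof (intro ballI impI)
          fix g h assume gh: "g \<in> F" "h \<in> F" "g \<noteq> h"
          then have G: "g \<in> carrier G" "h \<in> carrier G" using * LG by auto
          let ?d = "inv\<^bsub>G\<^esub> g \<otimes>\<^bsub>G\<^esub> h"
          have D: "?d \<in> ?D" using gh by force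
          have "?d \<noteq> \<one>\<^bsub>G\<^esub>"
          proof
            assume "?d = \<one>\<^bsub>G\<^esub>"
            then have "g \<otimes>\<^bsub>G\<^esub> ?d = g" using G by simp
            then show False using G gh by simp
          qed
          then show "\<phi> ?d x \<noteq> x"
            using x(2)[of ?d] moved[of ?d] D by (cases "?d \<in> M") (auto simp: I_def)
        qed
      qed (use * LG x in auto)
      with x show "\<exists>x\<in>E. inj_on (\<lambda>g. \<phi> g x) F" by blast
    qed
  qed
  ultimately show ?thesis by blast
qed

end
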